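(* Let $L,t_f\in\mathbb{R}^+$, $\alpha>-1/2$, $N_y,N_t\in\mathbb{Z}^+$, $D_{L,t_f}^2=[0,L]\times[0,t_f]$, and let $\phi,u:D_{L,t_f}^2\to\mathbb{R}$. Let $$\psi(y,t)=\phi(0,t)-\phi(y,t)+u(0,t)-u(y,t)\quad\forall (y,t)\in D_{L,t_f}^2 .$$ Suppose that $\psi(y,\cdot)\in C^{N_t+1}[0,t_f]$ for all $y\in[0,L]$, and $$\left\|\frac{\partial^k\phi}{\partial y^k}\right\|_{L^\infty(D_{L,t_f}^2)}\le A_{\max}\in\mathbb{R}^+\quad\forall k=0,\ldots,N_y+1 .$$ Then there exist numbers $\zeta_{L,N_y,i}^{(\alpha),y}=\zeta\big(y_{L,N_y,i}^{(\alpha)}\big)\in(0,L)$, $i=0,\ldots,N_y$, and $\zeta_{t_f,N_t,j}^{(\alpha),t}=\zeta\big(t_{t_f,N_t,j}^{(\alpha)}\big)\in(0,t_f)$, $j=0,\ldots,N_t$, such that, assuming $$\left\|\left[\frac{\partial^{N_t+1}}{\partial t^{N_t+1}}\psi(y,t)\right]_{t=\zeta_{t_f,N_t,j}^{(\alpha),t}}\right\|_{L^\infty[0,L]}\le B_{\max,j}\in\mathbb{R}^+\quad\forall j,$$ the barycentric shifted Gegenbauer pseudospectral method (BSGPM) discretizes the integral dynamical system equation $$I_{2,y}^{(y)}(\phi(y,t))+I_{1,t}^{(t)}\big(\phi(0,t)-\phi(y,t)+u(0,t)-u(y,t)\big)=f(y)-f(0)$$ with a total truncation error $E_{\mathrm{total},i,j}$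 at each SGG point $\big(y_{L,N_y,i}^{(\alpha)},t_{t_f,N_t,j}^{(\alpha)}\big)$ bounded by $$|E_{\mathrm{total},i,j}|\le D^{(\alpha)}(\varepsilon_{1,j}+\varepsilon_{2,i}),\qquad D^{(\alpha)}=\frac{\Gamma(1+\alpha)}{2\,\Gamma(1+2\alpha)},$$ where $$\varepsilon_{1,j}=\frac{4^{-N_t}\,B_{\max,j}\,t_f^{N_t+1}\,t_{t_f,N_t,j}^{(\alpha)}}{(N_t+1)!\,\Gamma(N_t+\alpha+1)}\times\begin{cases}\Gamma(N_t+2\alpha+1),&\alpha\ge0,\\[2mm]\dfrac{2|\alpha|\left|\binom{\frac{N_t}{2}+\alpha}{\frac{N_t}{2}}\right|(N_t+1)!\,|\Gamma(2\alpha)|}{\sqrt{(N_t+1)(N_t+2\alpha+1)}},&\frac{N_t}{2}\in\mathbb{Z}_0^+,\ -\frac12<\alpha<0,\\[3mm]\left|\binom{\frac{N_t-1}{2}+\alpha}{\frac{N_t+1}{2}}\right|(N_t+1)!\,|\Gamma(2\alpha)|,&\frac{N_t+1}{2}\in\mathbb{Z}^+,\ -\frac12<\alpha<0,\end{cases}$$ $$\varepsilon_{2,i}=\frac{A_{\max}\,n_{\max,i}\,2^{1-N_y}\,y_{L,N_y,i}^{(\alpha)}\,L^{N_y+1}\,\Gamma(N_y+2\alpha+1)}{(N_y+1)!\,\Gamma(1+N_y+\alpha)}\times\begin{cases}1,&\alpha\ge0,\\[2mm]\dfrac{2|\alpha|\left|\binom{\frac{N_y}{2}+\alpha}{\frac{N_y}{2}}\right|(N_y+1)!\,|\Gamma(2\alpha)|}{\sqrt{(N_y+1)(N_y+2\alpha+1)}\,\Gamma(N_y+2\alpha+1)},&\frac{N_y}{2}\in\mathbb{Z}_0^+,\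 -\frac12<\alpha<0,\\[3mm]\dfrac{\left|\binom{\frac{N_y-1}{2}+\alpha}{\frac{N_y+1}{2}}\right|(N_y+1)!\,|\Gamma(2\alpha)|}{\Gamma(N_y+2\alpha+1)},&\frac{N_y+1}{2}\in\mathbb{Z}^+,\ -\frac12<\alpha<0,\end{cases}$$ $$n_{\max,i}=\max\left\{1,\ \sup\left|y_{L,N_y,i}^{(\alpha)}-\zeta_{L,N_y,i}^{(\alpha),y}\right|\right\}.$$
   Context: $\mathbb{Z}_0^+=\mathbb{Z}^+\cup\{0\}$. For $l>0$, $\alpha>-1/2$, $G_{l,n}^{(\alpha)}(x)=G_n^{(\alpha)}(2x/l-1)$ is the $n$th-degree shifted Gegenbauer polynomial on $[0,l]$, where $G_n^{(\alpha)}$ is the degree-$n$ polynomial orthogonal on $[-1,1]$ with respect to the weight $(1-x^2)^{\alpha-1/2}$, normalized by $G_n^{(\alpha)}(1)=1$. The shifted Gegenbauer-Gauss (SGG) nodes $x_{l,n,k}^{(\alpha)}$, $k=0,\ldots,n$, are the zeros of $G_{l,n+1}^{(\alpha)}$ in increasing order; $y_{L,N_y,i}^{(\alpha)}$ and $t_{t_f,N_t,j}^{(\alpha)}$ denote these nodes for $(l,n)=(L,N_y)$ and $(l,n)=(t_f,N_t)$, respectively. For a bivariate function $\vartheta(y,t)$, $I_{q,\tilde y}^{(y)}(\vartheta(y,t))$ and $I_{q,\tilde t}^{(t)}(\vartheta(y,t))$ denote the $q$-fold iterated integrals with respect to $y$ from $0$ to $\tilde y$ and with respect to $t$ from $0$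 to $\tilde t$, e.g. $I_{1,\tilde t}^{(t)}(\vartheta(y,t))=\int_0^{\tilde t}\vartheta(y,\sigma)\,d\sigma$ and $I_{2,\tilde y}^{(y)}(\vartheta(y,t))=\int_0^{\tilde y}\int_0^{\sigma_1}\vartheta(\sigma_0,t)\,d\sigma_0\,d\sigma_1$. The function $f$ is the given initial datum on $[0,L]$ of the diffusion problem $x_t=x_{yy}+u$, $x(y,0)=f(y)$, $x_y(0,t)=x_y(L,t)=0$, and $\phi=x_{yy}$. The $q$th-order barycentric shifted Gegenbauer integration matrix on $[0,l]$ has rows ${}_l\mathbf{P}_{B,n,i}^{(q)}=[{}_lp_{B,n,i,0}^{(q)},\ldots,{}_lp_{B,n,i,n}^{(q)}]$, $i=0,\ldots,n$, with $${}_lp_{B,n,i,j}^{(1)}=\int_0^{x_{l,n,i}^{(\alpha)}}\mathcal{L}_j(x)\,dx,\qquad {}_lp_{B,n,i,j}^{(q)}=\frac{\big(x_{l,n,i}^{(\alpha)}-x_{l,n,j}^{(\alpha)}\big)^{q-1}}{(q-1)!}\,{}_lp_{B,n,i,j}^{(1)},$$ where $\mathcal{L}_j$ is the degree-$n$ Lagrange polynomial with $\mathcal{L}_j(x_{l,n,k}^{(\alpha)})=\delta_{jk}$. The BSGPM replaces, at $(y_i,t_j)=(y_{L,N_y,i}^{(\alpha)},t_{t_f,N_t,j}^{(\alpha)})$, the left-hand side of the integral dynamical system equation by $${}_L\mathbf{P}_{B,N_y,i}^{(2)}\,[\phi(y_s,t_j)]_{s=0}^{N_y}+{}_{t_f}\mathbf{P}_{B,N_t,j}^{(1)}\,[\psi(y_i,t_k)]_{k=0}^{N_t},$$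 the right-hand side $f(y_i)-f(0)$ being kept. The total truncation error is $$E_{\mathrm{total},i,j}=I_{2,y_i}^{(y)}(\phi(y,t_j))+I_{1,t_j}^{(t)}(\psi(y_i,t))-{}_L\mathbf{P}_{B,N_y,i}^{(2)}[\phi(y_s,t_j)]_{s=0}^{N_y}-{}_{t_f}\mathbf{P}_{B,N_t,j}^{(1)}[\psi(y_i,t_k)]_{k=0}^{N_t}.$$ Binomial coefficients with non-integer upper entry are defined by $\binom{a}{k}=\frac{\Gamma(a+1)}{\Gamma(k+1)\Gamma(a-k+1)}$.
   Formalization: The L^∞ norms are taken as pointwise suprema, not essential suprema: φ and u may be discontinuous in t or y, so with essential suprema the values on the lines through the SGG points are uncontrolled and the bound fails; for continuous derivatives the two agree. *)

theory Defs
  imports "HOL-Analysis.Analysis" "HOL-Computational_Algebra.Polynomial"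
begin

section \<open>Derivatives on closed intervals and sup norms\<close>

text \<open>
  Functions on a set \<open>S\<close> are represented by total functions, whose values outside \<open>S\<close>
  must not matter. Derivatives are therefore taken within \<open>S\<close> (one-sided at the
  endpoints of a closed interval).
\<close>

definition deriv_within :: "real set \<Rightarrow> nat \<Rightarrow> (real \<Rightarrow> real) \<Rightarrow> real \<Rightarrow> real" where
  "deriv_within S k g = ((\<lambda>h x. vector_derivative h (at x within S)) ^^ k) g"

definition times_differentiable_on :: "nat \<Rightarrow> real set \<Rightarrow> (real \<Rightarrow> real) \<Rightarrow> bool" where
  "times_differentiable_on n S g \<longleftrightarrow> (\<forall>k<n. deriv_within S k g differentiable_on S)"

definition C_class_on :: "nat \<Rightarrow> real set \<Rightarrow> (real \<Rightarrow> real) \<Rightarrow> bool" where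
  "C_class_on n S g \<longleftrightarrow> times_differentiable_on n S g \<and> continuous_on S (deriv_within S n g)"

text \<open>
  The \<open>L\<^sup>\<infinity>\<close> norm is the pointwise supremum, not the essential one: it is used to
  control values at single nodes, and the functions involved need not be continuous in
  both variables, nor even measurable. It is extended real valued, so an upper bound on
  it entails boundedness.
\<close>

definition sup_norm_on :: "'a set \<Rightarrow> ('a \<Rightarrow> real) \<Rightarrow> ereal" where
  "sup_norm_on A g = (SUP z\<in>A. ereal \<bar>g z\<bar>)"

primrec iter_integral :: "nat \<Rightarrow> (real \<Rightarrow> real) \<Rightarrow> real \<Rightarrow> real" where
  "iter_integral 0 g x = g x"
| "iter_integral (Suc q) g x = integral {0..x} (iter_integral q g)"


section \<open>Shifted Gegenbauer polynomials, nodes and integration matrices\<close>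

definition gegenbauer :: "real \<Rightarrow> nat \<Rightarrow> real poly" where
  "gegenbauer \<alpha> n = (THE p. degree p = n \<and> poly p 1 = 1 \<and>
     (\<forall>q. degree q < n \<longrightarrow>
        integral {-1..1} (\<lambda>x. (1 - x\<^sup>2) powr (\<alpha> - 1/2) * poly p x * poly q x) = 0))"

definition shifted_gegenbauer :: "real \<Rightarrow> real \<Rightarrow> nat \<Rightarrow> real poly" where
  "shifted_gegenbauer l \<alpha> n = pcompose (gegenbauer \<alpha> n) [:-1, 2 / l:]"

definition sgg_node :: "real \<Rightarrow> real \<Rightarrow> nat \<Rightarrow> nat \<Rightarrow> real" where
  "sgg_node l \<alpha> n k =
     sorted_list_of_set {x. poly (shifted_gegenbauer l \<alpha> (Suc n)) x = 0} ! k"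

definition lagrange_poly :: "real \<Rightarrow> real \<Rightarrow> nat \<Rightarrow> nat \<Rightarrow> real poly" where
  "lagrange_poly l \<alpha> n j = (THE p. degree p = n \<and>
     (\<forall>k\<le>n. poly p (sgg_node l \<alpha> n k) = (if j = k then 1 else 0)))"

text \<open>
  For \<open>q = 1\<close> the factor in front of the integral is \<open>1\<close> (also for \<open>i = j\<close>, as
  \<open>0 ^ 0 = 1\<close>), so that a single formula covers the first and the higher orders.
\<close>

definition bsgim :: "real \<Rightarrow> real \<Rightarrow> nat \<Rightarrow> nat \<Rightarrow> nat \<Rightarrow> nat \<Rightarrow> real" where
  "bsgim l \<alpha> q n i j =
     (sgg_node l \<alpha> n i - sgg_node l \<alpha> n j) ^ (q - 1) / fact (q - 1) *
     integral {0..sgg_node l \<alpha> n i} (poly (lagrange_poly l \<alpha> n j))"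


section \<open>The integral dynamical system equation and its discretization\<close>

definition psi :: "(real \<Rightarrow> real \<Rightarrow> real) \<Rightarrow> (real \<Rightarrow> real \<Rightarrow> real) \<Rightarrow> real \<Rightarrow> real \<Rightarrow> real" where
  "psi \<phi> u y t = \<phi> 0 t - \<phi> y t + u 0 t - u y t"

definition ids_lhs ::
    "(real \<Rightarrow> real \<Rightarrow> real) \<Rightarrow> (real \<Rightarrow> real \<Rightarrow> real) \<Rightarrow> real \<Rightarrow> real \<Rightarrow> real" where
  "ids_lhs \<phi> u y t = iter_integral 2 (\<lambda>s. \<phi> s t) y + iter_integral 1 (psi \<phi> u y) t"

definition bsgpm_lhs ::
    "real \<Rightarrow> real \<Rightarrow> real \<Rightarrow> nat \<Rightarrow> nat \<Rightarrow> (real \<Rightarrow> real \<Rightarrow> real) \<Rightarrow> (real \<Rightarrow> real \<Rightarrow> real)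
       \<Rightarrow> nat \<Rightarrow> nat \<Rightarrow> real" where
  "bsgpm_lhs L tf \<alpha> Ny Nt \<phi> u i j =
     (\<Sum>s\<le>Ny. bsgim L \<alpha> 2 Ny i s * \<phi> (sgg_node L \<alpha> Ny s) (sgg_node tf \<alpha> Nt j)) +
     (\<Sum>k\<le>Nt. bsgim tf \<alpha> 1 Nt j k * psi \<phi> u (sgg_node L \<alpha> Ny i) (sgg_node tf \<alpha> Nt k))"

definition E_total ::
    "real \<Rightarrow> real \<Rightarrow> real \<Rightarrow> nat \<Rightarrow> nat \<Rightarrow> (real \<Rightarrow> real \<Rightarrow> real) \<Rightarrow> (real \<Rightarrow> real \<Rightarrow> real)
       \<Rightarrow> nat \<Rightarrow> nat \<Rightarrow> real" where
  "E_total L tf \<alpha> Ny Nt \<phi> u i j =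
     ids_lhs \<phi> u (sgg_node L \<alpha> Ny i) (sgg_node tf \<alpha> Nt j) - bsgpm_lhs L tf \<alpha> Ny Nt \<phi> u i j"


section \<open>The error bound\<close>

definition Gamma_binomial :: "real \<Rightarrow> real \<Rightarrow> real" where
  "Gamma_binomial a k = Gamma (a + 1) / (Gamma (k + 1) * Gamma (a - k + 1))"

definition D_const :: "real \<Rightarrow> real" where
  "D_const \<alpha> = Gamma (1 + \<alpha>) / (2 * Gamma (1 + 2 * \<alpha>))"

text \<open>In \<open>eps1\<close> and \<open>eps2\<close>, \<open>x\<close> stands for the node (in time and in space, respectively).\<close>

definition eps1 :: "real \<Rightarrow> real \<Rightarrow> nat \<Rightarrow> real \<Rightarrow> real \<Rightarrow> real" where
  "eps1 tf \<alpha> N B x =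
     B * tf ^ (N + 1) * x / (4 ^ N * fact (N + 1) * Gamma (real N + \<alpha> + 1)) *
     (if \<alpha> \<ge> 0 then Gamma (real N + 2 * \<alpha> + 1)
      else if even N then
        2 * \<bar>\<alpha>\<bar> * \<bar>Gamma_binomial (real N / 2 + \<alpha>) (real N / 2)\<bar> * fact (N + 1) *
          \<bar>Gamma (2 * \<alpha>)\<bar> / sqrt ((real N + 1) * (real N + 2 * \<alpha> + 1))
      else
        \<bar>Gamma_binomial ((real N - 1) / 2 + \<alpha>) ((real N + 1) / 2)\<bar> * fact (N + 1) *
          \<bar>Gamma (2 * \<alpha>)\<bar>)"

definition eps2 :: "real \<Rightarrow> real \<Rightarrow> nat \<Rightarrow> real \<Rightarrow> real \<Rightarrow> real \<Rightarrow> real" where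
  "eps2 L \<alpha> N A nmax x =
     A * nmax * 2 powr (1 - real N) * x * L ^ (N + 1) * Gamma (real N + 2 * \<alpha> + 1) /
       (fact (N + 1) * Gamma (1 + real N + \<alpha>)) *
     (if \<alpha> \<ge> 0 then 1
      else if even N then
        2 * \<bar>\<alpha>\<bar> * \<bar>Gamma_binomial (real N / 2 + \<alpha>) (real N / 2)\<bar> * fact (N + 1) *
          \<bar>Gamma (2 * \<alpha>)\<bar> /
          (sqrt ((real N + 1) * (real N + 2 * \<alpha> + 1)) * Gamma (real N + 2 * \<alpha> + 1))
      else
        \<bar>Gamma_binomial ((real N - 1) / 2 + \<alpha>) ((real N + 1) / 2)\<bar> * fact (N + 1) *
          \<bar>Gamma (2 * \<alpha>)\<bar> / Gamma (real N + 2 * \<alpha> + 1))"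

end

theory Submission
  imports Defs
begin

text \<open>
  Both error terms are integrals over \<open>[0, x\<^sub>i]\<close> of an interpolation error \<open>g\<^sup>(\<^sup>n\<^sup>+\<^sup>1\<^sup>)(\<xi>)/(n+1)! * \<Prod>\<^sub>k (x - x\<^sub>k)\<close>,
  with \<open>g = \<psi>(y\<^sub>i, \<cdot>)\<close> in time and \<open>g(y) = (y\<^sub>i - y) \<phi>(y, t\<^sub>j)\<close> in space. As the node polynomial changes
  sign on \<open>[0, x\<^sub>i]\<close>, the mean value theorem for integrals does not apply; instead the integral is bounded by
  \<open>x\<^sub>i\<close> times the largest error, attained at some point. In space, Leibniz' rule gives
  \<open>|g\<^sup>(\<^sup>n\<^sup>+\<^sup>1\<^sup>)(\<xi>)| \<le> (|y\<^sub>i - \<xi>| + n + 1) A\<^sub>m\<^sub>a\<^sub>x\<close>, and \<open>n + 2 \<le> 2\<^sup>n\<^sup>+\<^sup>1\<close> explains the power of two in \<open>eps2\<close>.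

  The node polynomial is the monic shifted Gegenbauer polynomial. By the Gegenbauer equation,
  \<open>p\<^sup>2 + (1 - x\<^sup>2) p'\<^sup>2 / (n (n + 2\<alpha>))\<close> has derivative \<open>4 \<alpha> x p'\<^sup>2 / (n (n + 2\<alpha>))\<close>, so on \<open>[-1, 1]\<close> it is largest at
  \<open>\<plusminus>1\<close> if \<open>\<alpha> \<ge> 0\<close> and at \<open>0\<close> if \<open>\<alpha> < 0\<close>; the values there give the constants.
\<close>

section \<open>The Gegenbauer equation and orthogonality\<close>

text \<open>The operator of the Gegenbauer differential equation with the eigenvalue for degree
  \<open>n\<close> already added, so that the polynomial of degree \<open>n\<close> lies in its
  kernel.\<close>

definition gegenbauer_op :: "real \<Rightarrow> nat \<Rightarrow> real poly \<Rightarrow> real poly" where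
  "gegenbauer_op \<alpha> n q = [:1, 0, -1:] * pderiv (pderiv q)
     - smult (2 * \<alpha> + 1) ([:0, 1:] * pderiv q) + smult (real n * (real n + 2 * \<alpha>)) q"

text \<open>In the monomial basis the operator has a diagonal and one further band two places away.
  For \<alpha> > -1/2 the diagonal entry is positive when \<open>k < n\<close>, and it is zero when
  \<open>k = n\<close>. This yields both surjectivity below degree \<open>n\<close> and the
  recurrence for the coefficients of solutions.\<close>

lemma coeff_gegenbauer_op:
  "coeff (gegenbauer_op \<alpha> n q) k =
     (real k + 2) * (real k + 1) * coeff q (k + 2)
     + (real n - real k) * (real n + real k + 2 * \<alpha>) * coeff q k"
proof -
  have e: "[:1, 0, -1:] * r = r - monom 1 2 * r" for r :: "real poly"
    by (simp add: monom_altdef numeral_2_eq_2 power2_eq_square)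
  have x: "[:0, 1:] * r = monom 1 1 * r" for r :: "real poly"
    by (simp add: monom_altdef)
  consider "k = 0" | "k = 1" | j where "k = j + 2"
    by (metis One_nat_def Suc_eq_plus1 add_2_eq_Suc' not0_implies_Suc)
  then show ?thesis
    by cases (simp_all add: gegenbauer_op_def e x coeff_monom_mult coeff_pderiv algebra_simps
      numeral_2_eq_2)
qed

lemma gegenbauer_op_add:
  "gegenbauer_op \<alpha> n (p + q) = gegenbauer_op \<alpha> n p + gegenbauer_op \<alpha> n q"
  by (simp add: poly_eq_iff coeff_gegenbauer_op algebra_simps)

text \<open>Triangular solve: below degree \<open>n\<close> no diagonal entry vanishes, so the top
  coefficient of \<open>r\<close> is removed by a multiple of a monomial, whose image adds otherwise
  only terms of lower degree.\<close>

lemma gegenbauer_op_surj: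
  assumes "\<alpha> > -1/2" "m \<le> n" "\<And>k. k \<ge> m \<Longrightarrow> coeff r k = 0"
  shows "\<exists>q. gegenbauer_op \<alpha> n q = r"
  using assms(2,3)
proof (induction m arbitrary: r)
  case 0
  then have "r = 0" by (simp add: poly_eq_iff)
  then show ?case by (intro exI[of _ 0]) (simp add: gegenbauer_op_def)
next
  case (Suc m)
  define d where "d = (real n - real m) * (real n + real m + 2 * \<alpha>)"
  have "real n \<ge> real m + 1" using Suc.prems by linarith
  then have "real n - real m > 0" "real n + real m + 2 * \<alpha> > 0"
    using assms(1) by linarith+
  then have d: "d \<noteq> 0" by (simp add: d_def)
  define q where "q = monom (coeff r m / d) m"
  have "coeff (r - gegenbauer_op \<alpha> n q) k = 0" if "k \<ge> m" for k
    using that d Suc.prems(2)[of k]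
    by (cases "k = m") (auto simp: coeff_gegenbauer_op q_def d_def)
  with Suc.IH[of "r - gegenbauer_op \<alpha> n q"] Suc.prems obtain q' where
    "gegenbauer_op \<alpha> n q' = r - gegenbauer_op \<alpha> n q" by auto
  then have "gegenbauer_op \<alpha> n (q' + q) = r" by (simp add: gegenbauer_op_add)
  then show ?case by blast
qed

text \<open>Lagrange identity for the self-adjoint form of the equation: the integrand is the
  derivative of \<open>(1 - x^2)^(\<alpha> + 1/2) (p q' - p' q)\<close>, which vanishes at both ends
  because \<open>\<alpha> + 1/2 > 0\<close>.\<close>

lemma gegenbauer_op_integral:
  assumes \<alpha>: "\<alpha> > -1/2" and p: "gegenbauer_op \<alpha> n p = 0"
  shows "((\<lambda>x. (1 - x\<^sup>2) powr (\<alpha> - 1/2) * poly p x * poly (gegenbauer_op \<alpha> n q) x)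
           has_integral 0) {-1..1}"
proof -
  define W where "W = (\<lambda>x::real. (1 - x\<^sup>2) powr (\<alpha> + 1/2))"
  define r where "r = p * pderiv q - pderiv p * q"
  define F where "F = (\<lambda>x. W x * poly r x)"
  have "1 - x\<^sup>2 \<ge> 0" if "x \<in> {-1..1}" for x :: real
    using that by (auto simp: abs_square_le_1)
  then have cont: "continuous_on {-1..1} F"
    unfolding F_def W_def using \<alpha>
    by (intro continuous_intros continuous_on_powr') auto
  have der: "(F has_vector_derivative
      (1 - x\<^sup>2) powr (\<alpha> - 1/2) * poly p x * poly (gegenbauer_op \<alpha> n q) x) (at x)"
    if x: "x \<in> {-1<..<1}" for x
  proof -
    define w where "w = (1 - x\<^sup>2) powr (\<alpha> - 1/2)"
    have pos: "1 - x\<^sup>2 > 0" using x by (auto simp: abs_square_less_1)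
    have Wx: "W x = w * (1 - x\<^sup>2)"
    proof -
      have "W x = (1 - x\<^sup>2) powr ((\<alpha> - 1/2) + 1)" by (simp add: W_def add.commute)
      also have "\<dots> = w * (1 - x\<^sup>2)" using pos by (subst powr_add) (simp add: w_def)
      finally show ?thesis .
    qed
    have dW: "(W has_real_derivative (\<alpha> + 1/2) * w * (- 2 * x)) (at x)"
      unfolding W_def w_def using pos
      by (auto intro!: derivative_eq_intros simp: algebra_simps)
    have dr: "(poly r has_real_derivative poly (pderiv r) x) (at x)" by (rule poly_DERIV)
    have p0: "poly (gegenbauer_op \<alpha> n p) x = 0" using p by simp
    have dF: "(F has_real_derivative
        (\<alpha> + 1/2) * w * (- 2 * x) * poly r x + poly (pderiv r) x * W x) (at x)"
      unfolding F_def by (rule DERIV_mult[OF dW dr])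
    have r: "poly r x = poly p x * poly (pderiv q) x - poly (pderiv p) x * poly q x"
      by (simp add: r_def)
    have r': "poly (pderiv r) x =
        poly p x * poly (pderiv (pderiv q)) x - poly (pderiv (pderiv p)) x * poly q x"
      by (simp add: r_def pderiv_diff pderiv_mult algebra_simps)
    have p1: "(1 - x\<^sup>2) * poly (pderiv (pderiv p)) x
        = (2 * \<alpha> + 1) * x * poly (pderiv p) x - real n * (real n + 2 * \<alpha>) * poly p x"
      using p0 by (simp add: gegenbauer_op_def algebra_simps power2_eq_square)
    have q1: "poly (gegenbauer_op \<alpha> n q) x = (1 - x\<^sup>2) * poly (pderiv (pderiv q)) x
        - (2 * \<alpha> + 1) * x * poly (pderiv q) x + real n * (real n + 2 * \<alpha>) * poly q x"
      by (simp add: gegenbauer_op_def algebra_simps power2_eq_square)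
    have "(\<alpha> + 1/2) * w * (- 2 * x) * poly r x + poly (pderiv r) x * W x
        = w * (- (2 * \<alpha> + 1) * x * poly r x
            + poly p x * ((1 - x\<^sup>2) * poly (pderiv (pderiv q)) x)
            - ((1 - x\<^sup>2) * poly (pderiv (pderiv p)) x) * poly q x)"
      unfolding r' Wx by algebra
    \<comment> \<open>Once the second derivatives are eliminated, the terms in \<open>p q\<close>
      cancel and those with first derivatives cancel against the derivative of
      \<open>W\<close>.\<close>
    also have "\<dots> = w * poly p x * poly (gegenbauer_op \<alpha> n q) x"
      unfolding p1 q1 r by algebra
    finally show ?thesis
      using dF by (simp add: has_real_derivative_iff_has_vector_derivative w_def)
  qed
  have "((\<lambda>x. (1 - x\<^sup>2) powr (\<alpha> - 1/2) * poly p x * poly (gegenbauer_op \<alpha> n q) x)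
      has_integral F 1 - F (-1)) {-1..1}"
    \<comment> \<open>For \<alpha> < 1/2 the weight is unbounded near the end points; this version
      asks for derivatives only in the open interval and for continuity of \<open>F\<close> up to
      the ends.\<close>
    by (rule fundamental_theorem_of_calculus_interior[OF _ cont der]) auto
  then show ?thesis by (simp add: F_def W_def)
qed

text \<open>A polynomial of degree below \<open>n\<close> is in the image of the operator, so
  orthogonality reduces to the Lagrange identity.\<close>

lemma gegenbauer_op_orthogonal:
  assumes "\<alpha> > -1/2" "gegenbauer_op \<alpha> n p = 0" "degree q < n"
  shows "((\<lambda>x. (1 - x\<^sup>2) powr (\<alpha> - 1/2) * poly p x * poly q x) has_integral 0) {-1..1}"
proof -
  have "coeff q k = 0" if "k \<ge> n" for k
    using that assms(3) by (intro coeff_eq_0) simp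
  then obtain q' where "gegenbauer_op \<alpha> n q' = q"
    using gegenbauer_op_surj[OF assms(1) order_refl] by blast
  then show ?thesis using gegenbauer_op_integral[OF assms(1,2), of q'] by simp
qed

section \<open>Integrability and positivity of the Gegenbauer weight\<close>

text \<open>The substitution \<open>s = (x + 1) / 2\<close> turns the weight into a Beta integrand
  with both parameters \<open>\<alpha> + 1/2 > 0\<close>. Being nonnegative, it is absolutely
  integrable, and this survives multiplication by a polynomial, which is bounded here.\<close>

lemma gegenbauer_weight_integrable:
  fixes \<alpha> :: real
  assumes "\<alpha> > -1/2"
  shows "(\<lambda>x. (1 - x\<^sup>2) powr (\<alpha> - 1/2) * poly q x) integrable_on {-1..1}"
proof -
  define f where "f = (\<lambda>t::real. t powr (\<alpha> + 1/2 - 1) * (1 - t) powr (\<alpha> + 1/2 - 1))"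
  have "(f has_integral Beta (\<alpha> + 1/2) (\<alpha> + 1/2)) (cbox 0 1)"
    unfolding f_def using has_integral_Beta_real[of "\<alpha> + 1/2" "\<alpha> + 1/2"] assms by simp
  then have "(\<lambda>x. f (1/2 * x + 1/2)) integrable_on {-1..1}"
    using has_integral_affinity'[of f _ 0 1 "1/2" "1/2"] by auto
  then have "(\<lambda>x. 4 powr (\<alpha> - 1/2) * f (1/2 * x + 1/2)) integrable_on {-1..1}"
    by (rule integrable_on_mult_right)
  then have "(\<lambda>x. (1 - x\<^sup>2) powr (\<alpha> - 1/2)) integrable_on {-1..1}"
  proof (rule integrable_eq)
    fix x :: real assume x: "x \<in> {-1..1}"
    define s where "s = 1/2 * x + 1/2"
    have s: "0 \<le> s" "0 \<le> 1 - s" using x by (auto simp: s_def)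
    have e: "1 - x\<^sup>2 = 4 * (s * (1 - s))"
      by (simp add: s_def power2_eq_square field_simps)
    have "(1 - x\<^sup>2) powr (\<alpha> - 1/2) = 4 powr (\<alpha> - 1/2) * f s"
      unfolding e f_def using s by (subst powr_mult, simp, simp, subst powr_mult) auto
    then show "4 powr (\<alpha> - 1/2) * f (1/2 * x + 1/2) = (1 - x\<^sup>2) powr (\<alpha> - 1/2)"
      by (simp add: s_def)
  qed
  then have w: "(\<lambda>x. (1 - x\<^sup>2) powr (\<alpha> - 1/2)) absolutely_integrable_on {-1..1}"
    by (intro nonnegative_absolutely_integrable_1) auto
  have "(\<lambda>x. poly q x * (1 - x\<^sup>2) powr (\<alpha> - 1/2)) absolutely_integrable_on {-1..1}"
  proof (rule absolutely_integrable_bounded_measurable_product_real[OF _ _ _ w])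
    show "poly q \<in> borel_measurable (lebesgue_on {-1..1})"
      by (intro continuous_imp_measurable_on_sets_lebesgue continuous_intros) auto
    show "bounded (poly q ` {-1..1})"
      by (intro compact_imp_bounded compact_continuous_image continuous_intros) auto
  qed auto
  then have "(\<lambda>x. poly q x * (1 - x\<^sup>2) powr (\<alpha> - 1/2)) integrable_on {-1..1}"
    using absolutely_integrable_on_def by blast
  then show ?thesis by (simp add: mult.commute)
qed

text \<open>On \<open>[-1/2, 1/2]\<close> the weight is continuous and positive, so a zero integral
  of a nonnegative function makes \<open>q\<close> vanish there, at infinitely many points.\<close>

lemma gegenbauer_weight_integral_0:
  fixes \<alpha> :: real
  assumes \<alpha>: "\<alpha> > -1/2" and nn: "\<And>x. x \<in> {-1<..<1} \<Longrightarrow> poly q x \<ge> 0"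
    and i: "((\<lambda>x. (1 - x\<^sup>2) powr (\<alpha> - 1/2) * poly q x) has_integral 0) {-1..1}"
  shows "q = 0"
proof -
  let ?f = "\<lambda>x. (1 - x\<^sup>2) powr (\<alpha> - 1/2) * poly q x"
  \<comment> \<open>At the end points the base is 0 and \<open>powr\<close> returns 0, so the sign
    of \<open>q\<close> inside the interval decides.\<close>
  have f0: "?f x \<ge> 0" if "x \<in> {-1..1}" for x
    using that nn[of x] by (cases "x = 1 \<or> x = -1") (fastforce intro: mult_nonneg_nonneg)+
  have sub: "{-1/2..1/2} \<subseteq> {-1..1::real}" by auto
  have int: "?f integrable_on {-1..1}" using i by blast
  have int2: "?f integrable_on {-1/2..1/2}" by (rule integrable_subinterval_real[OF int sub])
  have "integral {-1/2..1/2} ?f \<le> 0"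
    using integral_subset_le[OF sub int2 int] f0 i by (simp add: integral_unique)
  moreover have "integral {-1/2..1/2} ?f \<ge> 0"
    using f0 by (intro integral_nonneg int2) auto
  ultimately have "integral {-1/2..1/2} ?f = 0" by linarith
  moreover have pos: "1 - x\<^sup>2 > 0" if "x \<in> {-1/2..1/2}" for x :: real
    using that abs_square_less_1[of x] by auto
  have "continuous_on {-1/2..1/2} ?f"
    by (intro continuous_intros) (use pos in force)
  ultimately have z: "?f x = 0" if "x \<in> {-1/2..1/2}" for x
    using integral_eq_0_iff[of "-1/2" "1/2" ?f] f0 that by force
  have "poly q x = 0" if "x \<in> {-1/2..1/2}" for x
    using z[OF that] pos[OF that] by simp
  then have "{-1/2..1/2} \<subseteq> {x. poly q x = 0}" by blast
  moreover have "infinite {-1/2..1/2::real}" by (simp add: infinite_Icc)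
  ultimately show ?thesis using poly_roots_finite[of q] finite_subset by blast
qed

section \<open>The explicit solution in powers of x - 1\<close>

text \<open>
  The coefficients of the Taylor expansion at \<open>1\<close>, that is of the hypergeometric series
  \<open>\<^sub>2F\<^sub>1(-n, n + 2\<alpha>; \<alpha> + 1/2; (1 - x)/2)\<close>.
\<close>

definition gegenbauer_coeff_at_1 :: "real \<Rightarrow> nat \<Rightarrow> nat \<Rightarrow> real" where
  "gegenbauer_coeff_at_1 \<alpha> n k =
     (\<Prod>j<k. (real n - real j) * (real n + real j + 2 * \<alpha>) /
        ((real j + 1) * (2 * real j + 2 * \<alpha> + 1)))"

definition gegenbauer_at_1 :: "real \<Rightarrow> nat \<Rightarrow> real poly" where
  "gegenbauer_at_1 \<alpha> n = Poly (map (gegenbauer_coeff_at_1 \<alpha> n) [0..<Suc n])"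

text \<open>Beyond \<open>n\<close> the product contains the zero factor with \<open>j = n\<close>,
  so cutting the list off after degree \<open>n\<close> loses nothing.\<close>

lemma coeff_gegenbauer_at_1: "coeff (gegenbauer_at_1 \<alpha> n) k = gegenbauer_coeff_at_1 \<alpha> n k"
proof (cases "k \<le> n")
  case True
  then show ?thesis
    by (simp add: gegenbauer_at_1_def coeff_Poly_eq nth_default_nth del: upt_Suc)
next
  case False
  then have "gegenbauer_coeff_at_1 \<alpha> n k = 0"
    by (auto simp: gegenbauer_coeff_at_1_def intro!: prod_zero bexI[of _ n])
  with False show ?thesis
    by (simp add: gegenbauer_at_1_def coeff_Poly_eq nth_default_beyond del: upt_Suc)
qed

lemma gegenbauer_coeff_at_1_pos:
  assumes "\<alpha> > -1/2" "k \<le> n"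
  shows "gegenbauer_coeff_at_1 \<alpha> n k > 0"
  unfolding gegenbauer_coeff_at_1_def
proof (rule prod_pos)
  fix j assume "j \<in> {..<k}"
  then have "real n \<ge> real j + 1" using assms(2) by simp
  then have "real n - real j > 0" "real n + real j + 2 * \<alpha> > 0" "2 * real j + 2 * \<alpha> + 1 > 0"
    using assms(1) by linarith+
  then show "0 < (real n - real j) * (real n + real j + 2 * \<alpha>) /
        ((real j + 1) * (2 * real j + 2 * \<alpha> + 1))" by simp
qed

lemma degree_gegenbauer_at_1:
  assumes "\<alpha> > -1/2"
  shows "degree (gegenbauer_at_1 \<alpha> n) = n"
proof (rule antisym)
  have "gegenbauer_coeff_at_1 \<alpha> n k = 0" if "k > n" for k
    using that by (auto simp: gegenbauer_coeff_at_1_def intro!: prod_zero bexI[of _ n])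
  then show "degree (gegenbauer_at_1 \<alpha> n) \<le> n"
    by (intro degree_le) (auto simp: coeff_gegenbauer_at_1)
  have "coeff (gegenbauer_at_1 \<alpha> n) n \<noteq> 0"
    using gegenbauer_coeff_at_1_pos[OF assms, of n n] by (simp add: coeff_gegenbauer_at_1)
  then show "n \<le> degree (gegenbauer_at_1 \<alpha> n)" by (rule le_degree)
qed

text \<open>With \<open>z = x - 1\<close> the factor \<open>1 - x^2\<close> becomes
  \<open>-2 z - z^2\<close>, and the equation turns into a one-step recurrence for the coefficients
  in powers of \<open>z\<close>, the one built into the product.\<close>

lemma gegenbauer_op_at_1:
  assumes "\<alpha> > -1/2"
  shows "gegenbauer_op \<alpha> n (pcompose (gegenbauer_at_1 \<alpha> n) [:-1, 1:]) = 0"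
proof -
  let ?Q = "gegenbauer_at_1 \<alpha> n"
  define R where "R = [:0, -2, -1:] * pderiv (pderiv ?Q)
    - smult (2 * \<alpha> + 1) ([:1, 1:] * pderiv ?Q) + smult (real n * (real n + 2 * \<alpha>)) ?Q"
  have "R = 0"
  proof (rule poly_eqI)
    fix k
    have rec: "gegenbauer_coeff_at_1 \<alpha> n (Suc i) * ((real i + 1) * (2 * real i + 2 * \<alpha> + 1))
        = gegenbauer_coeff_at_1 \<alpha> n i * ((real n - real i) * (real n + real i + 2 * \<alpha>))" for i
    proof -
      have "2 * real i + 2 * \<alpha> + 1 > 0" using assms by linarith
      then have "(real i + 1) * (2 * real i + 2 * \<alpha> + 1) \<noteq> 0" by auto
      then show ?thesis by (simp add: gegenbauer_coeff_at_1_def)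
    qed
    have quad: "coeff ([:0, b, c:] * r) i = b * (if i = 0 then 0 else coeff r (i - 1))
        + c * (if i \<le> 1 then 0 else coeff r (i - 2))" for b c :: real and r i
      by (auto simp: mult_pCons_left coeff_pCons numeral_2_eq_2 split: nat.splits)
    have lin: "coeff ([:1, 1:] * r) i = coeff r i + (if i = 0 then 0 else coeff r (i - 1))"
      for r :: "real poly" and i
      by (auto simp: mult_pCons_left coeff_pCons split: nat.splits)
    consider "k = 0" | "k = Suc 0" | j where "k = Suc (Suc j)"
      by (metis not0_implies_Suc)
    then have "coeff R k = gegenbauer_coeff_at_1 \<alpha> n k * ((real n - real k) * (real n + real k + 2 * \<alpha>))
      - gegenbauer_coeff_at_1 \<alpha> n (Suc k) * ((real k + 1) * (2 * real k + 2 * \<alpha> + 1))"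
      unfolding R_def coeff_gegenbauer_at_1[symmetric]
      by cases (simp_all only: coeff_add coeff_diff coeff_smult quad lin coeff_pderiv,
        simp_all add: algebra_simps)
    then show "coeff R k = coeff 0 k" using rec[of k] by simp
  qed
  moreover have "gegenbauer_op \<alpha> n (pcompose ?Q [:-1, 1:]) = pcompose R [:-1, 1:]"
  proof -
    have d: "pderiv (pcompose r [:-1, 1:]) = pcompose (pderiv r) [:-1, 1:]" for r :: "real poly"
      by (simp add: pderiv_pcompose pderiv_pCons)
    have "pcompose [:0, -2, -1:] [:-1, 1:] = [:1, 0, -1::real:]"
      "pcompose [:1, 1:] [:-1, 1:] = [:0, 1::real:]"
      by (simp_all add: pcompose_pCons)
    then show ?thesis
      unfolding R_def gegenbauer_op_def d pcompose_add pcompose_diff pcompose_mult pcompose_smult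
      by simp
  qed
  ultimately show ?thesis by simp
qed

section \<open>Identification of the normalized orthogonal polynomial\<close>

text \<open>Cross-multiplying with the leading coefficients gives a combination \<open>d\<close> of
  degree below \<open>n\<close>. It is orthogonal to \<open>p\<close> and \<open>p'\<close>, hence
  to itself, so it is zero; comparing values at 1 then makes the leading coefficients equal.\<close>

lemma gegenbauer_unique:
  fixes \<alpha> :: real
  assumes \<alpha>: "\<alpha> > -1/2"
    and p: "degree p = n" "poly p 1 = 1"
      "\<And>q. degree q < n \<Longrightarrow>
         integral {-1..1} (\<lambda>x. (1 - x\<^sup>2) powr (\<alpha> - 1/2) * poly p x * poly q x) = 0"
    and p': "degree p' = n" "poly p' 1 = 1"
      "\<And>q. degree q < n \<Longrightarrow>
         integral {-1..1} (\<lambda>x. (1 - x\<^sup>2) powr (\<alpha> - 1/2) * poly p' x * poly q x) = 0"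
  shows "p = p'"
proof -
  define d where "d = smult (lead_coeff p') p - smult (lead_coeff p) p'"
  let ?w = "\<lambda>x. (1 - x\<^sup>2) powr (\<alpha> - 1/2)"
  have d0: "d = 0"
  proof (cases "n = 0")
    case True
    then show ?thesis
      using p(1) p'(1) by (auto simp: d_def elim!: degree_eq_zeroE)
  next
    case False
    have "degree d \<le> n - 1"
    proof (intro degree_le allI impI)
      fix i assume "n - 1 < i"
      then have "i = n \<or> i > n" using False by linarith
      then show "coeff d i = 0"
        using p(1) p'(1) by (auto simp: d_def coeff_eq_0)
    qed
    then have deg: "degree d < n" using False by linarith
    \<comment> \<open>\<open>integral\<close> is 0 also for functions that are not integrable, so a
      zero value becomes a statement about \<open>has_integral\<close> only through integrability of
      the weighted polynomial.\<close>
    have int: "((\<lambda>x. ?w x * poly r x * poly d x) has_integral 0) {-1..1}"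
      if "integral {-1..1} (\<lambda>x. ?w x * poly r x * poly d x) = 0" for r
      using that gegenbauer_weight_integrable[OF \<alpha>, of "r * d"]
      by (metis (no_types, lifting) ext has_integral_integral mult.assoc poly_mult)
    have "((\<lambda>x. lead_coeff p' * (?w x * poly p x * poly d x)
        - lead_coeff p * (?w x * poly p' x * poly d x)) has_integral
        (lead_coeff p' * 0 - lead_coeff p * 0)) {-1..1}"
      using deg by (intro has_integral_diff has_integral_mult_right int p(3) p'(3))
    then have "((\<lambda>x. ?w x * poly (d * d) x) has_integral 0) {-1..1}"
      by (rule has_integral_eq_rhs[OF has_integral_eq, rotated]) (simp_all add: d_def algebra_simps)
    then have "d * d = 0"
      by (rule gegenbauer_weight_integral_0[OF \<alpha>, rotated]) simp
    then show ?thesis by simp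
  qed
  have "poly d 1 = 0" by (simp add: d0)
  then have "lead_coeff p = lead_coeff p'" by (simp add: d_def p(2) p'(2))
  moreover have "lead_coeff p \<noteq> 0" using p(2) by auto
  ultimately show ?thesis using d0 by (simp add: d_def flip: smult_diff_right)
qed

text \<open>The explicit solution meets all conditions of the definite description and uniqueness
  does the rest; this makes the differential equation available for
  \<open>gegenbauer\<close>.\<close>

lemma gegenbauer_eq:
  assumes "\<alpha> > -1/2"
  shows "gegenbauer \<alpha> n = pcompose (gegenbauer_at_1 \<alpha> n) [:-1, 1:]"
  unfolding gegenbauer_def
proof (rule the_equality)
  let ?P = "pcompose (gegenbauer_at_1 \<alpha> n) [:-1, 1:]"
  have "poly ?P 1 = coeff (gegenbauer_at_1 \<alpha> n) 0"
    by (simp add: poly_pcompose poly_0_coeff_0)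
  then show *: "degree ?P = n \<and> poly ?P 1 = 1 \<and> (\<forall>q. degree q < n \<longrightarrow>
      integral {-1..1} (\<lambda>x. (1 - x\<^sup>2) powr (\<alpha> - 1/2) * poly ?P x * poly q x) = 0)"
    using gegenbauer_op_orthogonal[OF assms gegenbauer_op_at_1[OF assms]]
    by (auto simp: coeff_gegenbauer_at_1 gegenbauer_coeff_at_1_def
        degree_gegenbauer_at_1[OF assms] degree_pcompose intro!: integral_unique)
  show "p = ?P" if "degree p = n \<and> poly p 1 = 1 \<and> (\<forall>q. degree q < n \<longrightarrow>
      integral {-1..1} (\<lambda>x. (1 - x\<^sup>2) powr (\<alpha> - 1/2) * poly p x * poly q x) = 0)" for p
    using that * by (intro gegenbauer_unique[OF assms, of p n]) auto
qed

lemma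
  assumes "\<alpha> > -1/2"
  shows gegenbauer_ode: "gegenbauer_op \<alpha> n (gegenbauer \<alpha> n) = 0"
    and degree_gegenbauer: "degree (gegenbauer \<alpha> n) = n"
    and poly_gegenbauer_1: "poly (gegenbauer \<alpha> n) 1 = 1"
    and lead_coeff_gegenbauer: "lead_coeff (gegenbauer \<alpha> n) = gegenbauer_coeff_at_1 \<alpha> n n"
proof -
  let ?Q = "gegenbauer_at_1 \<alpha> n"
  show "gegenbauer_op \<alpha> n (gegenbauer \<alpha> n) = 0"
    using gegenbauer_op_at_1[OF assms] by (simp add: gegenbauer_eq[OF assms])
  show deg: "degree (gegenbauer \<alpha> n) = n"
    by (simp add: gegenbauer_eq[OF assms] degree_gegenbauer_at_1[OF assms] degree_pcompose)
  have "poly (gegenbauer \<alpha> n) 1 = coeff ?Q 0"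
    by (simp add: gegenbauer_eq[OF assms] poly_pcompose poly_0_coeff_0)
  then show "poly (gegenbauer \<alpha> n) 1 = 1"
    by (simp add: coeff_gegenbauer_at_1 gegenbauer_coeff_at_1_def)
  have "lead_coeff (pcompose ?Q [:-1, 1:]) = lead_coeff ?Q"
    by (subst lead_coeff_comp) auto
  then show "lead_coeff (gegenbauer \<alpha> n) = gegenbauer_coeff_at_1 \<alpha> n n"
    by (simp add: gegenbauer_eq[OF assms] degree_gegenbauer_at_1[OF assms] degree_pcompose coeff_gegenbauer_at_1)
qed

section \<open>Zeros inside the interval\<close>

text \<open>The set constructed consists of the zeros of odd multiplicity in the interval: after
  multiplication by its factors every zero there has even multiplicity, so the sign is
  constant.\<close>

lemma poly_sign_change_points:
  fixes p :: "real poly"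
  assumes "p \<noteq> 0"
  shows "\<exists>A. finite A \<and> A \<subseteq> {z. a < z \<and> z < b \<and> poly p z = 0} \<and>
    ((\<forall>x\<in>{a<..<b}. poly p x * (\<Prod>z\<in>A. x - z) \<ge> 0) \<or>
     (\<forall>x\<in>{a<..<b}. poly p x * (\<Prod>z\<in>A. x - z) \<le> 0))"
  using assms
proof (induction "degree p" arbitrary: p rule: less_induct)
  case less
  show ?case
  proof (cases "\<exists>z. a < z \<and> z < b \<and> poly p z = 0")
    case False
    have "(\<forall>x\<in>{a<..<b}. poly p x \<ge> 0) \<or> (\<forall>x\<in>{a<..<b}. poly p x \<le> 0)"
    proof (rule ccontr)
      assume "\<not> ?thesis"
      then obtain x y where xy: "x \<in> {a<..<b}" "y \<in> {a<..<b}" "poly p x < 0" "0 < poly p y"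
        by (auto simp: not_le)
      then show False
        using poly_IVT_pos[of x y p] poly_IVT_neg[of y x p] False
        by (cases x y rule: linorder_cases) force+
    qed
    then show ?thesis by (intro exI[of _ "{}"]) auto
  next
    case True
    then obtain z where z: "a < z" "z < b" "poly p z = 0" by blast
    then obtain p1 where p1: "p = [:-z, 1:] * p1" by (metis poly_eq_0_iff_dvd dvdE)
    with less.prems have "p1 \<noteq> 0" by auto

    have "degree p1 < degree p"
      unfolding p1 using \<open>p1 \<noteq> 0\<close> by (subst degree_mult_eq) auto
    from less.hyps[OF this \<open>p1 \<noteq> 0\<close>] obtain A where A: "finite A" "A \<subseteq> {z. a < z \<and> z < b \<and> poly p1 z = 0}"
      and s: "(\<forall>x\<in>{a<..<b}. poly p1 x * (\<Prod>z\<in>A. x - z) \<ge> 0) \<or>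
        (\<forall>x\<in>{a<..<b}. poly p1 x * (\<Prod>z\<in>A. x - z) \<le> 0)"
      by blast
    show ?thesis
    \<comment> \<open>One more factor \<open>x - z\<close> flips the parity of the multiplicity of
      \<open>z\<close>, hence its membership in the set.\<close>
    proof (cases "z \<in> A")
      case True
      have "poly p x * (\<Prod>z\<in>A - {z}. x - z) = poly p1 x * (\<Prod>z\<in>A. x - z)" for x
        by (simp add: p1 prod.remove[OF A(1) True] algebra_simps)
      then show ?thesis
        using A s by (intro exI[of _ "A - {z}"]) (auto simp: p1)
    next
      case False
      have *: "poly p x * (\<Prod>z\<in>insert z A. x - z) = (x - z)\<^sup>2 * (poly p1 x * (\<Prod>z\<in>A. x - z))" for x
        using A(1) False by (simp add: p1 power2_eq_square algebra_simps)
      from s have "(\<forall>x\<in>{a<..<b}. poly p x * (\<Prod>z\<in>insert z A. x - z) \<ge> 0) \<or>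
        (\<forall>x\<in>{a<..<b}. poly p x * (\<Prod>z\<in>insert z A. x - z) \<le> 0)"
      proof
        assume "\<forall>x\<in>{a<..<b}. poly p1 x * (\<Prod>z\<in>A. x - z) \<ge> 0"
        then have "\<forall>x\<in>{a<..<b}. poly p x * (\<Prod>z\<in>insert z A. x - z) \<ge> 0"
          unfolding * by (auto intro: mult_nonneg_nonneg)
        then show ?thesis ..
      next
        assume "\<forall>x\<in>{a<..<b}. poly p1 x * (\<Prod>z\<in>A. x - z) \<le> 0"
        then have "\<forall>x\<in>{a<..<b}. poly p x * (\<Prod>z\<in>insert z A. x - z) \<le> 0"
          unfolding * by (auto intro: mult_nonneg_nonpos)
        then show ?thesis ..
      qed
      moreover have "insert z A \<subseteq> {z. a < z \<and> z < b \<and> poly p z = 0}"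
        using A(2) z by (auto simp: p1)
      ultimately show ?thesis using A(1) by (intro exI[of _ "insert z A"]) blast
    qed
  qed
qed

text \<open>With fewer than \<open>n\<close> sign changes in the open interval, the product
  \<open>r\<close> over them would have degree below \<open>n\<close> and be orthogonal to the
  polynomial, although their product keeps one sign. So there are at least \<open>n\<close> zeros
  inside, and the degree allows no others.\<close>

lemma gegenbauer_roots:
  assumes \<alpha>: "\<alpha> > -1/2"
  shows "\<exists>A \<subseteq> {-1<..<1}. finite A \<and> card A = n \<and> {x. poly (gegenbauer \<alpha> n) x = 0} = A"
proof -
  let ?p = "gegenbauer \<alpha> n"
  have p0: "?p \<noteq> 0" using poly_gegenbauer_1[OF \<alpha>, of n] by auto
  obtain A where A: "finite A" "A \<subseteq> {z. -1 < z \<and> z < 1 \<and> poly ?p z = 0}"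
    and s: "(\<forall>x\<in>{-1<..<1}. poly ?p x * (\<Prod>z\<in>A. x - z) \<ge> 0) \<or>
      (\<forall>x\<in>{-1<..<1}. poly ?p x * (\<Prod>z\<in>A. x - z) \<le> 0)"
    using poly_sign_change_points[OF p0, of "-1" 1] by blast
  define r where "r = (\<Prod>z\<in>A. [:-z, 1:])"
  have r: "poly r x = (\<Prod>z\<in>A. x - z)" for x
    by (simp add: r_def poly_prod)
  have degr: "degree r = card A" unfolding r_def
    by (subst degree_prod_eq_sum_degree) auto
  have r0: "r \<noteq> 0" unfolding r_def using A(1) by auto
  have ge: "card A \<ge> n"
  proof (rule ccontr)
    assume "\<not> card A \<ge> n"
    then have "((\<lambda>x. (1 - x\<^sup>2) powr (\<alpha> - 1/2) * poly ?p x * poly r x) has_integral 0) {-1..1}"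
      using degr by (intro gegenbauer_op_orthogonal[OF \<alpha> gegenbauer_ode[OF \<alpha>]]) simp
    then have i: "((\<lambda>x. (1 - x\<^sup>2) powr (\<alpha> - 1/2) * poly (?p * r) x) has_integral 0) {-1..1}"
      by (simp add: mult.assoc)
    then have i': "((\<lambda>x. (1 - x\<^sup>2) powr (\<alpha> - 1/2) * poly (- (?p * r)) x) has_integral 0) {-1..1}"
      using has_integral_neg[OF i] by simp
    from s have "?p * r = 0"
    proof
      assume "\<forall>x\<in>{-1<..<1}. poly ?p x * (\<Prod>z\<in>A. x - z) \<ge> 0"
      then show ?thesis by (intro gegenbauer_weight_integral_0[OF \<alpha> _ i]) (simp add: r)
    next
      assume "\<forall>x\<in>{-1<..<1}. poly ?p x * (\<Prod>z\<in>A. x - z) \<le> 0"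
      then have "- (?p * r) = 0" by (intro gegenbauer_weight_integral_0[OF \<alpha> _ i']) (simp add: r)
      then show ?thesis by simp
    qed
    with p0 r0 show False by simp
  qed
  have fin: "finite {x. poly ?p x = 0}" using p0 by (rule poly_roots_finite)
  have le: "card {x. poly ?p x = 0} \<le> n"
    using card_poly_roots_bound[OF p0] degree_gegenbauer[OF \<alpha>] by simp
  have sub: "A \<subseteq> {x. poly ?p x = 0}" using A(2) by blast
  then have "card A \<le> card {x. poly ?p x = 0}" by (rule card_mono[OF fin])
  with ge le have "card A = n" by linarith
  moreover have "A = {x. poly ?p x = 0}" by (rule card_seteq[OF fin sub]) (use ge le in linarith)
  ultimately show ?thesis using A by (intro exI[of _ A]) auto
qed

section \<open>Sup norm of Gegenbauer polynomials\<close>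

lemma coeff_gegenbauer_rec:
  assumes "\<alpha> > -1/2"
  shows "(real k + 2) * (real k + 1) * coeff (gegenbauer \<alpha> n) (k + 2) =
    - ((real n - real k) * (real n + real k + 2 * \<alpha>) * coeff (gegenbauer \<alpha> n) k)"
  using arg_cong[OF gegenbauer_ode[OF assms, of n], of "\<lambda>p. coeff p k"]
  unfolding coeff_gegenbauer_op by simp

text \<open>Parity: the coefficient at \<open>n + 1\<close> is zero, and the recurrence carries this
  down in steps of two.\<close>

lemma coeff_gegenbauer_eq_0:
  assumes \<alpha>: "\<alpha> > -1/2"
  shows "k + 2 * j + 1 = n \<Longrightarrow> coeff (gegenbauer \<alpha> n) k = 0"
proof (induction j arbitrary: k)
  case 0
  then have "coeff (gegenbauer \<alpha> n) (k + 2) = 0"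
    by (intro coeff_eq_0) (simp add: degree_gegenbauer[OF \<alpha>])
  moreover have "real n = real k + 1" using 0 by linarith
  moreover have "2 * real k + 1 + 2 * \<alpha> > 0" using \<alpha> by linarith
  ultimately show ?case using coeff_gegenbauer_rec[OF \<alpha>, of k n] by auto
next
  case (Suc j)
  then have "coeff (gegenbauer \<alpha> n) (k + 2) = 0" by (intro Suc.IH) simp
  moreover have "real n - real k > 0" "real n + real k + 2 * \<alpha> > 0"
    using Suc.prems \<alpha> by linarith+
  ultimately show ?case using coeff_gegenbauer_rec[OF \<alpha>, of k n] by auto
qed

text \<open>Descending from the leading coefficient by the two-step recurrence; the Gamma quotient
  collects the factors \<open>n - j + \<alpha>\<close> met on the way.\<close>

lemma coeff_gegenbauer:
  assumes \<alpha>: "\<alpha> > -1/2" and n: "n \<ge> 1"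
  shows "k + 2 * j = n \<Longrightarrow> coeff (gegenbauer \<alpha> n) k =
    (-1) ^ j * coeff (gegenbauer \<alpha> n) n * fact n * Gamma (real n - real j + \<alpha>) /
      (4 ^ j * fact j * fact k * Gamma (real n + \<alpha>))"
proof (induction j arbitrary: k)
  case 0
  have "Gamma (real n + \<alpha>) > 0" using \<alpha> n by (intro Gamma_real_pos) linarith
  with 0 show ?case by simp
next
  case (Suc j)
  define c where "c = coeff (gegenbauer \<alpha> n)"
  define s where "s = real n - real (Suc j) + \<alpha>"
  \<comment> \<open>The two factors of the recurrence are each twice something: together they give
    the 4, the next factor of the factorial, and the \<open>s\<close> that lowers the Gamma argument
    by one.\<close>
  have k: "real n - real k = 2 * (real j + 1)"
    "real n + real k + 2 * \<alpha> = 2 * s"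
    by (simp_all add: s_def Suc.prems[symmetric] algebra_simps)
  have pos: "s > 0" using Suc.prems[symmetric] \<alpha> by (simp add: s_def)
  have G0: "Gamma (real n + \<alpha>) > 0" using \<alpha> n by (intro Gamma_real_pos) linarith
  have "real n - real j + \<alpha> = s + 1" by (simp add: s_def)
  then have G: "Gamma (real n - real j + \<alpha>) =
      s * Gamma s"
    using pos by (metis Gamma_plus1 nonpos_Ints_nonpos not_less)
  have IH: "c (k + 2) = (-1) ^ j * c n * fact n * Gamma (real n - real j + \<alpha>) /
      (4 ^ j * fact j * fact (k + 2) * Gamma (real n + \<alpha>))"
    unfolding c_def using Suc.prems by (intro Suc.IH) simp
  have f: "fact (k + 2) = (real k + 2) * (real k + 1) * fact k"
    by (simp add: algebra_simps)
  have "(real n - real k) * (real n + real k + 2 * \<alpha>) * c k = - ((real k + 2) * (real k + 1) * c (k + 2))"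
    using coeff_gegenbauer_rec[OF \<alpha>, of k n] by (simp add: c_def)
  also have "\<dots> = - ((-1) ^ j * c n * fact n * Gamma (real n - real j + \<alpha>) /
      (4 ^ j * fact j * fact k * Gamma (real n + \<alpha>)))"
  proof -
    have cancel: "d * (X / (P * (d * F) * G)) = X / (P * F * G)" if "d \<noteq> 0" for d X P F G :: real
      using that by (simp add: field_simps)
    have "real k + 2 > 0" "real k + 1 > 0" by linarith+
    then have "(real k + 2) * (real k + 1) \<noteq> 0" by simp
    then show ?thesis unfolding IH f by (subst cancel) simp_all
  qed
  finally have "s * (4 * (real j + 1) * c k) =
      s * ((-1) ^ Suc j * c n * fact n * Gamma s /
      (4 ^ j * fact j * fact k * Gamma (real n + \<alpha>)))"
    unfolding k G by (simp only: mult_ac power_Suc) (simp add: field_simps)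
  then have "4 * (real j + 1) * c k = (-1) ^ Suc j * c n * fact n * Gamma s /
      (4 ^ j * fact j * fact k * Gamma (real n + \<alpha>))"
    using pos by (simp only: mult_cancel_left) simp
  then have "c k = (-1) ^ Suc j * c n * fact n * Gamma s /
      (4 ^ j * fact j * fact k * Gamma (real n + \<alpha>)) / (4 * (real j + 1))"
  proof -
    have "4 * (real j + 1) > 0" by simp
    then have "4 * (real j + 1) \<noteq> 0" by simp
    then show ?thesis
      using \<open>4 * (real j + 1) * c k = _\<close> by (metis nonzero_mult_div_cancel_left)
  qed
  also have "\<dots> = (-1) ^ Suc j * c n * fact n * Gamma s /
      (4 ^ Suc j * fact (Suc j) * fact k * Gamma (real n + \<alpha>))"
    by (simp add: mult_ac add.commute divide_divide_eq_left)
  finally show ?case unfolding c_def s_def .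
qed

text \<open>The leading coefficient is the last Taylor coefficient at 1. Its products are Pochhammer
  symbols, and the one shifted by 1/2 is removed by the duplication formula.\<close>

lemma lead_coeff_gegenbauer_Gamma:
  assumes \<alpha>: "\<alpha> > -1/2" and n: "n \<ge> 1"
  shows "coeff (gegenbauer \<alpha> n) n =
    2 ^ n * Gamma (2 * \<alpha> + 1) * Gamma (real n + \<alpha>) /
      (2 * Gamma (real n + 2 * \<alpha>) * Gamma (\<alpha> + 1))"
proof -
  have pos: "2 * \<alpha> + 1 > 0" "\<alpha> + 1 > 0" "real n + \<alpha> > 0" "real n + 2 * \<alpha> > 0"
      "2 * real n + 2 * \<alpha> > 0"
    using \<alpha> n by linarith+
  have np: "x \<notin> \<int>\<^sub>\<le>\<^sub>0" if "x > 0" for x :: real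
    using that nonpos_Ints_nonpos not_less by blast
  have "coeff (gegenbauer \<alpha> n) n = gegenbauer_coeff_at_1 \<alpha> n n"
    using lead_coeff_gegenbauer[OF \<alpha>, of n] degree_gegenbauer[OF \<alpha>, of n] by simp
  also have "\<dots> = (\<Prod>j<n. real n - real j) / (\<Prod>j<n. real j + 1)
      * (\<Prod>j<n. real n + real j + 2 * \<alpha>) / (\<Prod>j<n. 2 * real j + 2 * \<alpha> + 1)"
    by (simp add: gegenbauer_coeff_at_1_def prod_dividef prod.distrib)
  also have "(\<Prod>j<n. real n - real j) = (\<Prod>j<n. real j + 1)"
    by (rule prod.reindex_bij_witness[of _ "\<lambda>j. n - 1 - j" "\<lambda>j. n - 1 - j"])
      (auto simp: of_nat_diff)
  also have "(\<Prod>j<n. real j + 1) / (\<Prod>j<n. real j + 1) = 1"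
  proof -
    have "(\<Prod>j<n. real j + 1) > 0" by (intro prod_pos) auto
    then show ?thesis by simp
  qed
  also have "(\<Prod>j<n. real n + real j + 2 * \<alpha>) = pochhammer (real n + 2 * \<alpha>) n"
    by (simp add: pochhammer_prod atLeast0LessThan add_ac)
  also have "\<dots> = Gamma (2 * real n + 2 * \<alpha>) / Gamma (real n + 2 * \<alpha>)"
    using pochhammer_Gamma[OF np[OF pos(4)], of n] by (simp add: algebra_simps)
  also have "(\<Prod>j<n. 2 * real j + 2 * \<alpha> + 1) = 2 ^ n * pochhammer (\<alpha> + 1/2) n"
  proof -
    have "(\<Prod>j<n. 2 * real j + 2 * \<alpha> + 1) = (\<Prod>j<n. 2 * (\<alpha> + 1/2 + real j))"
      by (intro prod.cong) (auto simp: algebra_simps)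
    then show ?thesis by (simp only: prod.distrib) (simp add: pochhammer_prod atLeast0LessThan)
  qed
  also have "pochhammer (\<alpha> + 1/2) n = Gamma (2 * \<alpha> + 1 + 2 * real n) * Gamma (\<alpha> + 1) /
      (Gamma (2 * \<alpha> + 1) * 4 ^ n * Gamma (\<alpha> + 1 + real n))"
  proof -
    have "pochhammer (2 * (\<alpha> + 1/2)) (2 * n) =
        of_nat (2 ^ (2 * n)) * pochhammer (\<alpha> + 1/2) n * pochhammer (\<alpha> + 1/2 + 1/2) n"
      by (rule pochhammer_double)
    moreover have "2 * (\<alpha> + 1/2) = 2 * \<alpha> + 1" "\<alpha> + 1/2 + 1/2 = \<alpha> + 1" by simp_all
    moreover have "real (2 ^ (2 * n)) = 4 ^ n" by (simp add: power_mult)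
    ultimately have "pochhammer (2 * \<alpha> + 1) (2 * n) =
        4 ^ n * pochhammer (\<alpha> + 1/2) n * pochhammer (\<alpha> + 1) n"
      by (simp only:)
    moreover have "pochhammer (\<alpha> + 1) n = Gamma (\<alpha> + 1 + real n) / Gamma (\<alpha> + 1)"
      using pochhammer_Gamma[OF np[OF pos(2)]] by simp
    moreover have "pochhammer (2 * \<alpha> + 1) (2 * n) = Gamma (2 * \<alpha> + 1 + 2 * real n) / Gamma (2 * \<alpha> + 1)"
      using pochhammer_Gamma[OF np[OF pos(1)], of "2 * n"] by simp
    moreover have "Gamma (\<alpha> + 1 + real n) > 0" "Gamma (\<alpha> + 1) > 0" "Gamma (2 * \<alpha> + 1) > 0"
      using pos by (auto intro!: Gamma_real_pos)
    ultimately show ?thesis by (simp add: field_simps)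
  qed
  \<comment> \<open>Lowering this argument by one exposes the
    \<open>Gamma (2 n + 2 \<alpha>)\<close> that cancels against the numerator.\<close>
  also have "Gamma (2 * \<alpha> + 1 + 2 * real n) = 2 * (real n + \<alpha>) * Gamma (2 * real n + 2 * \<alpha>)"
    using Gamma_plus1[OF np[OF pos(5)]] by (simp add: algebra_simps)
  also have "Gamma (\<alpha> + 1 + real n) = (real n + \<alpha>) * Gamma (real n + \<alpha>)"
    using Gamma_plus1[OF np[OF pos(3)]] by (simp add: algebra_simps)
  finally have *: "coeff (gegenbauer \<alpha> n) n = 1 * (Gamma (2 * real n + 2 * \<alpha>) / Gamma (real n + 2 * \<alpha>))
     / (2 ^ n * (2 * (real n + \<alpha>) * Gamma (2 * real n + 2 * \<alpha>) * Gamma (\<alpha> + 1) /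
      (Gamma (2 * \<alpha> + 1) * 4 ^ n * ((real n + \<alpha>) * Gamma (real n + \<alpha>)))))" .
  have 4: "(4::real) ^ n = 2 ^ n * 2 ^ n" by (simp flip: power_mult_distrib)
  have "Gamma (2 * real n + 2 * \<alpha>) > 0" "Gamma (real n + 2 * \<alpha>) > 0" "Gamma (\<alpha> + 1) > 0"
    "Gamma (2 * \<alpha> + 1) > 0" "Gamma (real n + \<alpha>) > 0" "real n + \<alpha> \<noteq> 0"
    using pos by (auto intro!: Gamma_real_pos)
  then show ?thesis unfolding * 4 by (simp add: divide_simps)
qed

section \<open>The energy function and bounds on [-1, 1]\<close>

text \<open>The Sonin function of the equation: on \<open>[-1, 1]\<close> it dominates the square of
  the polynomial and agrees with it at the end points.\<close>

definition gegenbauer_energy :: "real \<Rightarrow> nat \<Rightarrow> real \<Rightarrow> real" where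
  "gegenbauer_energy \<alpha> n x = (poly (gegenbauer \<alpha> n) x)\<^sup>2 +
     (1 - x\<^sup>2) * (poly (pderiv (gegenbauer \<alpha> n)) x)\<^sup>2 / (real n * (real n + 2 * \<alpha>))"

text \<open>Eliminating \<open>(1 - x^2) p''\<close> through the equation cancels the terms in
  \<open>p p'\<close>, because the divisor is the eigenvalue, and leaves
  \<open>2 (2 \<alpha> + 1) - 2 = 4 \<alpha>\<close> times \<open>x p'^2\<close>.\<close>

lemma gegenbauer_energy_deriv:
  assumes \<alpha>: "\<alpha> > -1/2" and n: "n \<ge> 1"
  shows "(gegenbauer_energy \<alpha> n has_real_derivative
    4 * (\<alpha> * x) * (poly (pderiv (gegenbauer \<alpha> n)) x)\<^sup>2 / (real n * (real n + 2 * \<alpha>))) (at x)"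
proof -
  define p where "p = gegenbauer \<alpha> n"
  define l where "l = real n * (real n + 2 * \<alpha>)"
  have "real n + 2 * \<alpha> > 0" using \<alpha> n by linarith
  then have l: "l \<noteq> 0" using n by (simp add: l_def)
  have "poly (gegenbauer_op \<alpha> n p) x = 0" by (simp add: p_def gegenbauer_ode[OF \<alpha>])
  then have ode: "(1 - x\<^sup>2) * poly (pderiv (pderiv p)) x =
      (2 * \<alpha> + 1) * x * poly (pderiv p) x - l * poly p x"
    by (simp add: gegenbauer_op_def l_def algebra_simps power2_eq_square)
  have "((\<lambda>x. (poly p x)\<^sup>2 + (1 - x\<^sup>2) * (poly (pderiv p) x)\<^sup>2 / l) has_real_derivative
      2 * poly p x * poly (pderiv p) x + ((- 2 * x) * (poly (pderiv p) x)\<^sup>2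
        + 2 * poly (pderiv p) x * ((1 - x\<^sup>2) * poly (pderiv (pderiv p)) x)) / l) (at x)"
    using l by (auto intro!: derivative_eq_intros simp: divide_simps)
  also have "2 * poly p x * poly (pderiv p) x + ((- 2 * x) * (poly (pderiv p) x)\<^sup>2
        + 2 * poly (pderiv p) x * ((1 - x\<^sup>2) * poly (pderiv (pderiv p)) x)) / l
      = 4 * (\<alpha> * x) * (poly (pderiv p) x)\<^sup>2 / l"
    unfolding ode using l by (simp add: field_simps power2_eq_square)
  finally show ?thesis
    by (simp add: gegenbauer_energy_def[abs_def] p_def l_def)
qed

lemma gegenbauer_le_energy:
  assumes \<alpha>: "\<alpha> > -1/2" and n: "n \<ge> 1" and x: "\<bar>x\<bar> \<le> 1"
  shows "(poly (gegenbauer \<alpha> n) x)\<^sup>2 \<le> gegenbauer_energy \<alpha> n x"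
proof -
  have "real n + 2 * \<alpha> > 0" using \<alpha> n by linarith
  moreover have "1 - x\<^sup>2 \<ge> 0" using x by (simp add: abs_square_le_1)
  ultimately show ?thesis by (simp add: gegenbauer_energy_def)
qed

text \<open>Only powers of the parity of \<open>n\<close> occur, so the value at -1 is
  \<open>(-1)^n\<close> times the value at 1.\<close>

lemma poly_gegenbauer_neg1_sq:
  assumes \<alpha>: "\<alpha> > -1/2"
  shows "(poly (gegenbauer \<alpha> n) (-1))\<^sup>2 = 1"
proof -
  let ?p = "gegenbauer \<alpha> n"
  have "coeff ?p k * (-1) ^ k = (-1) ^ n * coeff ?p k" if "k \<le> n" for k
  proof (cases "even (n - k)")
    case True
    then have "(-1) ^ n = ((-1) ^ k :: real)"
      using that by (metis even_diff_nat minus_one_power_iff not_less even_add)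
    then show ?thesis by simp
  next
    case False
    then obtain j where "n - k = 2 * j + 1" by (elim oddE)
    then have "k + 2 * j + 1 = n" using that by linarith
    then show ?thesis using coeff_gegenbauer_eq_0[OF \<alpha>, of k j n] by simp
  qed
  then have "poly ?p (-1) = (\<Sum>k\<le>n. (-1) ^ n * coeff ?p k)"
    unfolding poly_altdef degree_gegenbauer[OF \<alpha>] by (intro sum.cong) auto
  also have "\<dots> = (-1) ^ n * poly ?p 1"
    by (simp add: poly_altdef degree_gegenbauer[OF \<alpha>] sum_distrib_left)
  finally show ?thesis by (simp add: poly_gegenbauer_1[OF \<alpha>] power_mult_distrib flip: power_mult)
qed

text \<open>For \<alpha> \<ge> 0 the energy does not decrease away from 0, and at both ends it is
  the squared value 1.\<close>

lemma abs_gegenbauer_le_1: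
  assumes \<alpha>: "\<alpha> \<ge> 0" and n: "n \<ge> 1" and x: "\<bar>x\<bar> \<le> 1"
  shows "\<bar>poly (gegenbauer \<alpha> n) x\<bar> \<le> 1"
proof -
  have \<alpha>': "\<alpha> > -1/2" using \<alpha> by simp
  have "gegenbauer_energy \<alpha> n x \<le> 1"
  proof (cases "x \<ge> 0")
    case True
    have "gegenbauer_energy \<alpha> n x \<le> gegenbauer_energy \<alpha> n 1"
    proof (rule DERIV_nonneg_imp_nondecreasing[where f = "gegenbauer_energy \<alpha> n"])
      show "x \<le> 1" using x by simp
      fix z assume "x \<le> z" "z \<le> 1"
      then show "\<exists>y. (gegenbauer_energy \<alpha> n has_real_derivative y) (at z) \<and> 0 \<le> y"
        using True \<alpha> gegenbauer_energy_deriv[OF \<alpha>' n, of z]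
        by (intro exI[of _ "4 * (\<alpha> * z) * (poly (pderiv (gegenbauer \<alpha> n)) z)\<^sup>2 / (real n * (real n + 2 * \<alpha>))"]) simp
    qed
    then show ?thesis by (simp add: gegenbauer_energy_def poly_gegenbauer_1[OF \<alpha>'])
  next
    case False
    have "gegenbauer_energy \<alpha> n x \<le> gegenbauer_energy \<alpha> n (-1)"
    proof (rule DERIV_nonpos_imp_nonincreasing[where f = "gegenbauer_energy \<alpha> n"])
      show "-1 \<le> x" using x by simp
      fix z assume "-1 \<le> z" "z \<le> x"
      then have "z \<le> 0" using False by simp
      then have "\<alpha> * z \<le> 0" using \<alpha> by (intro mult_nonneg_nonpos)
      then have "4 * (\<alpha> * z) * (poly (pderiv (gegenbauer \<alpha> n)) z)\<^sup>2 / (real n * (real n + 2 * \<alpha>)) \<le> 0"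
        using \<alpha> by (intro divide_nonpos_nonneg mult_nonpos_nonneg[of "4 * (\<alpha> * z)"]) simp_all
      then show "\<exists>y. (gegenbauer_energy \<alpha> n has_real_derivative y) (at z) \<and> y \<le> 0"
        using gegenbauer_energy_deriv[OF \<alpha>' n] by blast 
    qed
    then show ?thesis by (simp add: gegenbauer_energy_def poly_gegenbauer_neg1_sq[OF \<alpha>'])
  qed
  with gegenbauer_le_energy[OF \<alpha>' n x] have "(poly (gegenbauer \<alpha> n) x)\<^sup>2 \<le> 1" by linarith
  then show ?thesis by (simp add: abs_square_le_1)
qed

text \<open>For \<alpha> < 0 the energy does not increase away from 0, and at 0 the value and the
  derivative are the two lowest coefficients. By parity one of them will vanish.\<close>

lemma gegenbauer_sq_le_neg:
  assumes \<alpha>: "\<alpha> > -1/2" "\<alpha> < 0" and n: "n \<ge> 1" and x: "\<bar>x\<bar> \<le> 1"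
  shows "(poly (gegenbauer \<alpha> n) x)\<^sup>2 \<le> (coeff (gegenbauer \<alpha> n) 0)\<^sup>2 +
    (coeff (gegenbauer \<alpha> n) 1)\<^sup>2 / (real n * (real n + 2 * \<alpha>))"
proof -
  have l: "real n * (real n + 2 * \<alpha>) \<ge> 0" using \<alpha> n by (intro mult_nonneg_nonneg) linarith+
  have "gegenbauer_energy \<alpha> n x \<le> gegenbauer_energy \<alpha> n 0"
  proof (cases "x \<ge> 0")
    case True
    show ?thesis
    proof (rule DERIV_nonpos_imp_nonincreasing[OF True])
      fix z :: real assume "0 \<le> z"
      then have "\<alpha> * z \<le> 0" using \<alpha> by (intro mult_nonpos_nonneg) auto
      then have "4 * (\<alpha> * z) * (poly (pderiv (gegenbauer \<alpha> n)) z)\<^sup>2 / (real n * (real n + 2 * \<alpha>)) \<le> 0"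
        using l by (intro divide_nonpos_nonneg mult_nonpos_nonneg[of "4 * (\<alpha> * z)"]) simp_all
      then show "\<exists>y. (gegenbauer_energy \<alpha> n has_real_derivative y) (at z) \<and> y \<le> 0"
        using gegenbauer_energy_deriv[OF \<alpha>(1) n] by blast
    qed
  next
    case False
    then have "x \<le> 0" by simp
    then show ?thesis
    proof (rule DERIV_nonneg_imp_nondecreasing[where f = "gegenbauer_energy \<alpha> n"])
      fix z :: real assume "z \<le> 0"
      then have "\<alpha> * z \<ge> 0" using \<alpha> by (intro mult_nonpos_nonpos) auto
      then have "0 \<le> 4 * (\<alpha> * z) * (poly (pderiv (gegenbauer \<alpha> n)) z)\<^sup>2 / (real n * (real n + 2 * \<alpha>))"
        using l by (intro divide_nonneg_nonneg mult_nonneg_nonneg[of "4 * (\<alpha> * z)"]) simp_all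
      then show "\<exists>y. (gegenbauer_energy \<alpha> n has_real_derivative y) (at z) \<and> 0 \<le> y"
        using gegenbauer_energy_deriv[OF \<alpha>(1) n] by blast
    qed
  qed
  with gegenbauer_le_energy[OF \<alpha>(1) n x] show ?thesis
    by (simp add: gegenbauer_energy_def poly_0_coeff_0 coeff_pderiv)
qed

text \<open>The case distinction of \<open>eps1\<close>, isolated because it depends only on the sup
  norm of the monic polynomial.\<close>

definition gegenbauer_factor :: "real \<Rightarrow> nat \<Rightarrow> real" where
  "gegenbauer_factor \<alpha> N =
     (if \<alpha> \<ge> 0 then Gamma (real N + 2 * \<alpha> + 1)
      else if even N then
        2 * \<bar>\<alpha>\<bar> * \<bar>Gamma_binomial (real N / 2 + \<alpha>) (real N / 2)\<bar> * fact (N + 1) *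
          \<bar>Gamma (2 * \<alpha>)\<bar> / sqrt ((real N + 1) * (real N + 2 * \<alpha> + 1))
      else
        \<bar>Gamma_binomial ((real N - 1) / 2 + \<alpha>) ((real N + 1) / 2)\<bar> * fact (N + 1) *
          \<bar>Gamma (2 * \<alpha>)\<bar>)"

text \<open>A bound for the monic polynomial, multiplied by the leading coefficient. For \<alpha>
  \<ge> 0 it comes from the end points; for \<alpha> < 0 from the energy at 0, evaluated with the
  closed form of the lowest coefficient that survives parity.\<close>

lemma abs_gegenbauer_le:
  assumes \<alpha>: "\<alpha> > -1/2" and x: "\<bar>x\<bar> \<le> 1"
  shows "\<bar>poly (gegenbauer \<alpha> (Suc N)) x\<bar> \<le> coeff (gegenbauer \<alpha> (Suc N)) (Suc N) *
    (2 ^ (N + 1) * D_const \<alpha> * gegenbauer_factor \<alpha> N / (4 ^ N * Gamma (real N + \<alpha> + 1)))"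
proof -
  let ?p = "gegenbauer \<alpha> (Suc N)"
  define K where "K = coeff ?p (Suc N)"
  define \<Gamma> where "\<Gamma> = Gamma (real N + \<alpha> + 1)"
  have np: "x \<notin> \<int>\<^sub>\<le>\<^sub>0" if "x > 0" for x :: real
    using that nonpos_Ints_nonpos not_less by blast
  have pos: "Gamma (2 * \<alpha> + 1) > 0" "Gamma (\<alpha> + 1) > 0" "\<Gamma> > 0"
      "Gamma (real N + 2 * \<alpha> + 1) > 0"
    unfolding \<Gamma>_def using \<alpha> by (auto intro!: Gamma_real_pos)
  have Gs: "Gamma (real (Suc N) + \<alpha>) = \<Gamma>" "Gamma (real (Suc N) + 2 * \<alpha>) = Gamma (real N + 2 * \<alpha> + 1)"
    by (simp_all add: \<Gamma>_def add_ac)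
  have K: "K = 2 ^ N * Gamma (2 * \<alpha> + 1) * \<Gamma> / (Gamma (real N + 2 * \<alpha> + 1) * Gamma (\<alpha> + 1))"
    unfolding K_def using lead_coeff_gegenbauer_Gamma[OF \<alpha>, of "Suc N"] Gs by simp
  have Kpos: "K > 0" unfolding K using pos by (intro divide_pos_pos mult_pos_pos) auto
  have D: "D_const \<alpha> = Gamma (\<alpha> + 1) / (2 * Gamma (2 * \<alpha> + 1))"
    by (simp add: D_const_def add.commute)
  have 4: "(4::real) ^ m = 2 ^ m * 2 ^ m" for m by (simp flip: power_mult_distrib)
  have "\<bar>poly ?p x\<bar> \<le> K * (2 ^ (N + 1) * D_const \<alpha> * gegenbauer_factor \<alpha> N / (4 ^ N * \<Gamma>))"
  proof (cases "\<alpha> \<ge> 0")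
    case True
    \<comment> \<open>The constant is the exact reciprocal of the leading coefficient.\<close>
    have "K * (2 ^ (N + 1) * D_const \<alpha> * gegenbauer_factor \<alpha> N / (4 ^ N * \<Gamma>)) = 1"
      using pos[THEN less_imp_neq] True by (simp add: K D gegenbauer_factor_def 4)
    then show ?thesis using abs_gegenbauer_le_1[OF True _ x, of "Suc N"] by (simp only:)
  next
    case False
    then have neg: "\<alpha> < 0" by simp
    \<comment> \<open>Both arguments lie strictly between -1 and 0, hence off the poles of
      Gamma.\<close>
    have nz: "\<alpha> \<notin> \<int>\<^sub>\<le>\<^sub>0" "2 * \<alpha> \<notin> \<int>\<^sub>\<le>\<^sub>0"
    proof -
      have "2 * \<alpha> \<notin> \<int>\<^sub>\<le>\<^sub>0"
      proof
        assume "2 * \<alpha> \<in> \<int>\<^sub>\<le>\<^sub>0"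
        then obtain i :: int where "2 * \<alpha> = of_int i" by (auto elim: nonpos_Ints_cases)
        then have "-1 < (of_int i :: real)" "(of_int i :: real) < 0" using \<alpha> neg by linarith+
        then have "-1 < i" "i < 0" by linarith+
        then show False by linarith
      qed
      moreover have "\<alpha> \<notin> \<int>\<^sub>\<le>\<^sub>0"
      proof
        assume "\<alpha> \<in> \<int>\<^sub>\<le>\<^sub>0"
        then obtain i :: int where "\<alpha> = of_int i" by (auto elim: nonpos_Ints_cases)
        then have "-1 < (of_int i :: real)" "(of_int i :: real) < 0" using \<alpha> neg by linarith+
        then have "-1 < i" "i < 0" by linarith+
        then show False by linarith
      qed
      ultimately show "\<alpha> \<notin> \<int>\<^sub>\<le>\<^sub>0" "2 * \<alpha> \<notin> \<int>\<^sub>\<le>\<^sub>0" by auto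
    qed
    have G1: "Gamma (\<alpha> + 1) = \<alpha> * Gamma \<alpha>" by (rule Gamma_plus1[OF nz(1)])
    have G2: "Gamma (2 * \<alpha> + 1) = 2 * \<bar>\<alpha>\<bar> * \<bar>Gamma (2 * \<alpha>)\<bar>"
    proof -
      have "Gamma (2 * \<alpha> + 1) = 2 * \<alpha> * Gamma (2 * \<alpha>)" by (rule Gamma_plus1[OF nz(2)])
      then have "\<bar>Gamma (2 * \<alpha> + 1)\<bar> = 2 * \<bar>\<alpha>\<bar> * \<bar>Gamma (2 * \<alpha>)\<bar>" by (simp add: abs_mult)
      then show ?thesis using pos(1) by simp
    qed
    \<comment> \<open>Removes the Gamma value at the negative argument
      \<open>2 \<alpha>\<close>.\<close>
    have D1: "D_const \<alpha> * (2 * \<bar>\<alpha>\<bar> * \<bar>Gamma (2 * \<alpha>)\<bar>) = Gamma (\<alpha> + 1) / 2"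
      unfolding D G2[symmetric] using pos by simp
    note bound = gegenbauer_sq_le_neg[OF \<alpha> neg _ x, of "Suc N"]
    show ?thesis
    proof (cases "even N")
      case True
      then obtain m where m: "N = 2 * m" by (elim evenE)
      define l where "l = (real N + 1) * (real N + 2 * \<alpha> + 1)"
      have l: "l > 0" unfolding l_def using \<alpha> by (intro mult_pos_pos) linarith+
      \<comment> \<open>Even \<open>N\<close> means odd degree: only the derivative at 0 enters the
        energy, hence the square root of the eigenvalue in the bound.\<close>
      have c0: "coeff ?p 0 = 0" by (rule coeff_gegenbauer_eq_0[OF \<alpha>, of 0 m]) (simp add: m)
      have c1: "\<bar>coeff ?p 1\<bar> = K * fact (N + 1) * Gamma (real m + \<alpha> + 1) / (4 ^ m * fact m * \<Gamma>)"
      proof -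
        have Gm: "Gamma (real m + \<alpha> + 1) > 0" using \<alpha> by (intro Gamma_real_pos) linarith
        have e: "real (Suc N) - real m + \<alpha> = real m + \<alpha> + 1" by (simp add: m)
        have "coeff ?p 1 = (-1) ^ m * K * fact (Suc N) * Gamma (real m + \<alpha> + 1) / (4 ^ m * fact m * fact 1 * \<Gamma>)"
          using coeff_gegenbauer[OF \<alpha>, of "Suc N" 1 m] unfolding K_def e Gs by (simp add: m)
        then show ?thesis using Kpos Gm pos by (simp add: abs_mult power_abs)
      qed
      have "(poly ?p x)\<^sup>2 \<le> (\<bar>coeff ?p 1\<bar> / sqrt l)\<^sup>2"
        using bound c0 l by (simp add: l_def power_divide add_ac)
      then have "\<bar>poly ?p x\<bar> \<le> \<bar>coeff ?p 1\<bar> / sqrt l"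
        using l by (intro power2_le_imp_le[of "\<bar>poly ?p x\<bar>"]) simp_all
      also have "\<dots> = K * (2 ^ (N + 1) * D_const \<alpha> * gegenbauer_factor \<alpha> N / (4 ^ N * \<Gamma>))"
      proof -
        have b: "\<bar>Gamma_binomial (real N / 2 + \<alpha>) (real N / 2)\<bar> =
            Gamma (real m + \<alpha> + 1) / (fact m * Gamma (\<alpha> + 1))"
        proof -
          have Gm: "Gamma (real m + \<alpha> + 1) > 0" using \<alpha> by (intro Gamma_real_pos) linarith
          have "Gamma (1 + real m) = fact m" by (rule Gamma_fact)
          then show ?thesis using Gm pos by (simp add: Gamma_binomial_def m abs_mult add.commute)
        qed
        have "gegenbauer_factor \<alpha> N = (2 * \<bar>\<alpha>\<bar> * \<bar>Gamma (2 * \<alpha>)\<bar>) *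
            (Gamma (real m + \<alpha> + 1) / (fact m * Gamma (\<alpha> + 1)) * fact (N + 1) / sqrt l)"
          using neg True b by (simp add: gegenbauer_factor_def l_def)
        then have "D_const \<alpha> * gegenbauer_factor \<alpha> N = Gamma (\<alpha> + 1) / 2 *
            (Gamma (real m + \<alpha> + 1) / (fact m * Gamma (\<alpha> + 1)) * fact (N + 1) / sqrt l)"
          using D1 by (metis mult.assoc)
        also have "\<dots> = Gamma (real m + \<alpha> + 1) / (2 * fact m) * fact (N + 1) / sqrt l"
        proof -
          have "G / 2 * (X / (F * G) * Y / S) = X / (2 * F) * Y / S" if "G \<noteq> 0" for G X F Y S :: real
            using that by simp
          then show ?thesis using pos(2) by (metis less_irrefl)
        qed
        finally have f: "D_const \<alpha> * gegenbauer_factor \<alpha> N =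
            Gamma (real m + \<alpha> + 1) / (2 * fact m) * fact (N + 1) / sqrt l" .
        have p: "(2::real) ^ (N + 1) / 4 ^ N = 2 / 4 ^ m"
        proof -
          have "(2::real) ^ (N + 1) = 2 * 4 ^ m" by (simp add: m power_mult)
          moreover have "(4::real) ^ N = 4 ^ m * 4 ^ m" by (simp add: m mult_2 power_add)
          ultimately show ?thesis by simp
        qed
        have "K * (2 ^ (N + 1) * D_const \<alpha> * gegenbauer_factor \<alpha> N / (4 ^ N * \<Gamma>)) =
            K * ((2 ^ (N + 1) / 4 ^ N) * (D_const \<alpha> * gegenbauer_factor \<alpha> N) / \<Gamma>)"
          by simp
        also have "\<dots> = \<bar>coeff ?p 1\<bar> / sqrt l"
          unfolding p f c1 by (simp only: times_divide_eq_left times_divide_eq_right divide_divide_eq_left) (simp add: mult_ac)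
        finally show ?thesis by simp
      qed
      finally show ?thesis .
    next
      case False
      then obtain i where i: "N = 2 * i + 1" by (elim oddE)
      define m where "m = Suc i"
      have N: "Suc N = 2 * m" by (simp add: m_def i)
      have Nr: "real N = 2 * real m - 1" using N by linarith
      have Gm: "Gamma (real m + \<alpha>) > 0" using \<alpha> by (intro Gamma_real_pos) (simp add: m_def)
      \<comment> \<open>Odd \<open>N\<close> means even degree: only the value at 0 enters.\<close>
      have c1: "coeff ?p 1 = 0" by (rule coeff_gegenbauer_eq_0[OF \<alpha>, of 1 i]) (simp add: i)
      have c0: "\<bar>coeff ?p 0\<bar> = K * fact (N + 1) * Gamma (real m + \<alpha>) / (4 ^ m * fact m * \<Gamma>)"
      proof -
        have e: "real (Suc N) - real m + \<alpha> = real m + \<alpha>" by (simp add: N)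
        have "coeff ?p 0 = (-1) ^ m * K * fact (Suc N) * Gamma (real m + \<alpha>) / (4 ^ m * fact m * fact 0 * \<Gamma>)"
          using coeff_gegenbauer[OF \<alpha>, of "Suc N" 0 m] unfolding K_def e Gs by (simp add: N)
        then show ?thesis using Kpos Gm pos by (simp add: abs_mult power_abs)
      qed
      have "(poly ?p x)\<^sup>2 \<le> \<bar>coeff ?p 0\<bar>\<^sup>2"
        using bound c1 by simp
      then have "\<bar>poly ?p x\<bar> \<le> \<bar>coeff ?p 0\<bar>"
        by (intro power2_le_imp_le[of "\<bar>poly ?p x\<bar>"]) simp_all
      also have "\<dots> = K * (2 ^ (N + 1) * D_const \<alpha> * gegenbauer_factor \<alpha> N / (4 ^ N * \<Gamma>))"
      proof -
        \<comment> \<open>The third Gamma argument of this binomial is \<alpha> itself, where Gamma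
          is negative; absolute values deal with the sign.\<close>
        have b: "2 * \<bar>\<alpha>\<bar> * \<bar>Gamma_binomial ((real N - 1) / 2 + \<alpha>) ((real N + 1) / 2)\<bar> =
            2 * \<bar>\<alpha>\<bar> * (Gamma (real m + \<alpha>) / (fact m * \<bar>Gamma \<alpha>\<bar>))"
        proof -
          have "Gamma (1 + real m) = fact m" by (rule Gamma_fact)
          moreover have e: "(real N - 1) / 2 + \<alpha> + 1 = real m + \<alpha>" "(real N + 1) / 2 + 1 = 1 + real m"
            "(real N - 1) / 2 + \<alpha> - (real N + 1) / 2 + 1 = \<alpha>"
            by (simp_all add: Nr field_simps)
          ultimately have "Gamma_binomial ((real N - 1) / 2 + \<alpha>) ((real N + 1) / 2) =
              Gamma (real m + \<alpha>) / (fact m * Gamma \<alpha>)"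
            unfolding Gamma_binomial_def e by simp
          then show ?thesis using Gm by (simp add: abs_mult)
        qed
        have "gegenbauer_factor \<alpha> N =
            \<bar>Gamma_binomial ((real N - 1) / 2 + \<alpha>) ((real N + 1) / 2)\<bar> * fact (N + 1) * \<bar>Gamma (2 * \<alpha>)\<bar>"
          using neg False by (simp add: gegenbauer_factor_def)
        \<comment> \<open>The factor \<open>2 |\<alpha>|\<close> is inserted twice and divided out:
          once to match \<open>D1\<close>, once to accompany the binomial, whose
          \<open>|Gamma \<alpha>|\<close> then cancels against
          \<open>Gamma (\<alpha> + 1)\<close>.\<close>
        also have "\<dots> = (2 * \<bar>\<alpha>\<bar> * \<bar>Gamma (2 * \<alpha>)\<bar>) *
            (2 * \<bar>\<alpha>\<bar> * \<bar>Gamma_binomial ((real N - 1) / 2 + \<alpha>) ((real N + 1) / 2)\<bar>) * fact (N + 1) / (4 * \<bar>\<alpha>\<bar> * \<bar>\<alpha>\<bar>)"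
          using neg by simp
        finally have "D_const \<alpha> * gegenbauer_factor \<alpha> N = (D_const \<alpha> * (2 * \<bar>\<alpha>\<bar> * \<bar>Gamma (2 * \<alpha>)\<bar>)) *
            ((2 * \<bar>\<alpha>\<bar> * \<bar>Gamma_binomial ((real N - 1) / 2 + \<alpha>) ((real N + 1) / 2)\<bar>) * fact (N + 1) / (4 * \<bar>\<alpha>\<bar> * \<bar>\<alpha>\<bar>))"
          by (simp only: times_divide_eq_right mult.assoc)
        then have "D_const \<alpha> * gegenbauer_factor \<alpha> N = Gamma (\<alpha> + 1) / 2 *
            (2 * \<bar>\<alpha>\<bar> * (Gamma (real m + \<alpha>) / (fact m * \<bar>Gamma \<alpha>\<bar>)) * fact (N + 1) / (4 * \<bar>\<alpha>\<bar> * \<bar>\<alpha>\<bar>))"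
          unfolding b D1 .
        also have "Gamma (\<alpha> + 1) = \<bar>\<alpha>\<bar> * \<bar>Gamma \<alpha>\<bar>"
          using G1 pos(2) by (metis abs_mult abs_of_pos)
        also have "\<bar>\<alpha>\<bar> * \<bar>Gamma \<alpha>\<bar> / 2 *
            (2 * \<bar>\<alpha>\<bar> * (Gamma (real m + \<alpha>) / (fact m * \<bar>Gamma \<alpha>\<bar>)) * fact (N + 1) / (4 * \<bar>\<alpha>\<bar> * \<bar>\<alpha>\<bar>))
            = Gamma (real m + \<alpha>) / (4 * fact m) * fact (N + 1)"
        proof -
          have "\<bar>Gamma \<alpha>\<bar> \<noteq> 0" using G1 pos(2) by auto
          moreover have "\<bar>\<alpha>\<bar> \<noteq> 0" using neg by simp
          ultimately show ?thesis by (simp add: divide_simps)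
        qed
        finally have f: "D_const \<alpha> * gegenbauer_factor \<alpha> N =
            Gamma (real m + \<alpha>) / (4 * fact m) * fact (N + 1)" .
        have p: "(2::real) ^ (N + 1) / 4 ^ N = 4 / 4 ^ m"
        proof -
          have e: "N + 1 = 2 * m" using N by simp
          have "(2::real) ^ (N + 1) = 4 ^ m" unfolding e by (simp add: power_mult)
          moreover have "4 * (4::real) ^ N = 4 ^ (N + 1)" by simp
          then have "4 * (4::real) ^ N = 4 ^ m * 4 ^ m" unfolding e by (simp add: mult_2 power_add)
          ultimately show ?thesis by (simp add: field_simps)
        qed
        have "K * (2 ^ (N + 1) * D_const \<alpha> * gegenbauer_factor \<alpha> N / (4 ^ N * \<Gamma>)) =
            K * ((2 ^ (N + 1) / 4 ^ N) * (D_const \<alpha> * gegenbauer_factor \<alpha> N) / \<Gamma>)"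
          by simp
        also have "\<dots> = \<bar>coeff ?p 0\<bar>"
          unfolding p f c0 by (simp only: times_divide_eq_left times_divide_eq_right divide_divide_eq_left) (simp add: mult_ac)
        finally show ?thesis by simp
      qed
      finally show ?thesis .
    qed
  qed
  then show ?thesis unfolding K_def \<Gamma>_def .
qed

section \<open>Nodes and interpolation\<close>

text \<open>Subtracting the leading coefficient times the product over the zeros leaves degree below
  \<open>n\<close> or the zero polynomial; since all \<open>n\<close> zeros remain, it is
  zero.\<close>

lemma gegenbauer_factorization:
  assumes \<alpha>: "\<alpha> > -1/2"
  obtains A where "A \<subseteq> {-1<..<1}" "finite A" "card A = n" "{x. poly (gegenbauer \<alpha> n) x = 0} = A"
    "\<And>x. poly (gegenbauer \<alpha> n) x = coeff (gegenbauer \<alpha> n) n * (\<Prod>z\<in>A. x - z)"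
proof -
  obtain A where A: "A \<subseteq> {-1<..<1}" "finite A" "card A = n" "{x. poly (gegenbauer \<alpha> n) x = 0} = A"
    using gegenbauer_roots[OF \<alpha>, of n] by blast
  define r where "r = (\<Prod>z\<in>A. [:-z, 1:])"
  define d where "d = gegenbauer \<alpha> n - smult (coeff (gegenbauer \<alpha> n) n) r"
  have degr: "degree r = n" unfolding r_def A(3)[symmetric]
    by (subst degree_prod_eq_sum_degree) auto
  have "lead_coeff r = (\<Prod>z\<in>A. lead_coeff [:-z, 1:])"
    unfolding r_def by (rule lead_coeff_prod)
  then have "coeff r n = 1" using degr by simp
  then have c0: "coeff d n = 0" by (simp add: d_def)
  have le: "degree d \<le> n" unfolding d_def
    by (intro degree_diff_le degree_smult_le[THEN order_trans])
      (simp_all add: degr degree_gegenbauer[OF \<alpha>])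
  have "d = 0"
  proof (rule ccontr)
    assume d: "d \<noteq> 0"
    then have "degree d \<noteq> n" using c0 by auto
    moreover have "A \<subseteq> {x. poly d x = 0}"
    proof
      fix z assume z: "z \<in> A"
      then have "poly r z = 0" using A(2) by (auto simp: r_def poly_prod intro: prod_zero)
      moreover have "poly (gegenbauer \<alpha> n) z = 0" using z A(4) by blast
      ultimately show "z \<in> {x. poly d x = 0}" by (simp add: d_def)
    qed
    then have "n \<le> card {x. poly d x = 0}"
      using card_mono[OF poly_roots_finite[OF d]] A(3) by blast
    ultimately show False using card_poly_roots_bound[OF d] le by linarith
  qed
  then have "poly (gegenbauer \<alpha> n) x = coeff (gegenbauer \<alpha> n) n * (\<Prod>z\<in>A. x - z)" for x
  proof -
    have r: "poly r x = (\<Prod>z\<in>A. x - z)" for x by (simp add: r_def poly_prod)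
    have "poly d x = 0" using \<open>d = 0\<close> by simp
    then show ?thesis by (simp only: d_def poly_diff poly_smult r right_minus_eq)
  qed
  with A that show ?thesis by blast
qed

text \<open>The affine map \<open>s\<close> from \<open>[-1, 1]\<close> onto \<open>[0, l]\<close>
  carries the zeros to the nodes, so the node polynomial is a rescaled monic Gegenbauer
  polynomial.\<close>

lemma sgg_nodes:
  assumes \<alpha>: "\<alpha> > -1/2" and l: "l > 0"
  shows inj_on_sgg_node: "inj_on (sgg_node l \<alpha> n) {..n}"
    and sgg_node_bounds: "k \<le> n \<Longrightarrow> sgg_node l \<alpha> n k \<in> {0<..<l}"
    and abs_prod_sgg_node_le: "x \<in> {0..l} \<Longrightarrow> \<bar>\<Prod>k\<le>n. x - sgg_node l \<alpha> n k\<bar> \<le>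
      l ^ (n + 1) * D_const \<alpha> * gegenbauer_factor \<alpha> n / (4 ^ n * Gamma (real n + \<alpha> + 1))"
proof -
  define p where "p = gegenbauer \<alpha> (Suc n)"
  define K where "K = coeff p (Suc n)"
  obtain A where A: "A \<subseteq> {-1<..<1}" "finite A" "card A = Suc n" "{x. poly p x = 0} = A"
    "\<And>x. poly p x = K * (\<Prod>z\<in>A. x - z)"
    unfolding p_def K_def using gegenbauer_factorization[OF \<alpha>] by metis
  define s where "s = (\<lambda>z. l * (z + 1) / 2)"
  define Z where "Z = {x. poly (shifted_gegenbauer l \<alpha> (Suc n)) x = 0}"
  have inj_s: "inj s" using l by (auto simp: inj_def s_def)
  have "Z = s ` A"
  proof -
    have "Z = {x. 2 / l * x - 1 \<in> A}"
      using A(4) by (auto simp: Z_def shifted_gegenbauer_def poly_pcompose p_def mult.commute)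
    also have "\<dots> = s ` A"
    proof (intro equalityI subsetI)
      fix x assume "x \<in> {x. 2 / l * x - 1 \<in> A}"
      moreover have "x = s (2 / l * x - 1)" using l by (simp add: s_def)
      ultimately show "x \<in> s ` A" by blast
    next
      fix x assume "x \<in> s ` A"
      then show "x \<in> {x. 2 / l * x - 1 \<in> A}" using l by (auto simp: s_def)
    qed
    finally show ?thesis .
  qed
  then have fin: "finite Z" and card: "card Z = Suc n"
    using A(2,3) card_image[OF inj_on_subset[OF inj_s]] by auto
  have bij: "bij_betw (sgg_node l \<alpha> n) {..n} Z"
  proof -
    have "bij_betw ((!) (sorted_list_of_set Z)) {..n} Z"
      using fin card by (intro bij_betw_nth) auto
    then show ?thesis by (simp add: sgg_node_def[abs_def] Z_def)
  qed
  then show "inj_on (sgg_node l \<alpha> n) {..n}" by (rule bij_betw_imp_inj_on)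
  show "sgg_node l \<alpha> n k \<in> {0<..<l}" if "k \<le> n"
  proof -
    have "sgg_node l \<alpha> n k \<in> s ` A"
      using bij_betwE[OF bij] that \<open>Z = s ` A\<close> by blast
    then obtain z where z: "z \<in> A" "sgg_node l \<alpha> n k = s z" by blast
    then have "z + 1 > 0" "z + 1 < 2" using A(1) by auto
    then have "0 < l * (z + 1)" "l * (z + 1) < l * 2" using l by auto
    then show ?thesis using z by (simp add: s_def)
  qed
  show "\<bar>\<Prod>k\<le>n. x - sgg_node l \<alpha> n k\<bar> \<le>
      l ^ (n + 1) * D_const \<alpha> * gegenbauer_factor \<alpha> n / (4 ^ n * Gamma (real n + \<alpha> + 1))"
    if x: "x \<in> {0..l}"
  proof -
    let ?M = "D_const \<alpha> * gegenbauer_factor \<alpha> n / (4 ^ n * Gamma (real n + \<alpha> + 1))"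
    define y where "y = 2 / l * x - 1"
    have "2 / l * x \<le> 2" "2 / l * x \<ge> 0" using x l by (auto simp: field_simps)
    then have y: "\<bar>y\<bar> \<le> 1" by (auto simp: y_def)
    have Kpos: "K > 0"
    proof -
      have "K = gegenbauer_coeff_at_1 \<alpha> (Suc n) (Suc n)"
        using lead_coeff_gegenbauer[OF \<alpha>, of "Suc n"] degree_gegenbauer[OF \<alpha>, of "Suc n"]
        by (simp add: K_def p_def)
      then show ?thesis using gegenbauer_coeff_at_1_pos[OF \<alpha>] by simp
    qed
    have "(\<Prod>k\<le>n. x - sgg_node l \<alpha> n k) = (\<Prod>z\<in>Z. x - z)"
      by (rule prod.reindex_bij_betw[OF bij])
    also have "\<dots> = (\<Prod>z\<in>A. x - s z)"
      unfolding \<open>Z = s ` A\<close> by (subst prod.reindex) (auto intro: inj_on_subset[OF inj_s])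
    \<comment> \<open>Each of the \<open>n + 1\<close> factors scales by \<open>l / 2\<close>; the
      powers of two cancel later against those in the sup norm bound.\<close>
    also have "\<dots> = (\<Prod>z\<in>A. (l / 2) * (y - z))"
      using l by (intro prod.cong) (auto simp: s_def y_def field_simps)
    also have "\<dots> = (l / 2) ^ Suc n * (\<Prod>z\<in>A. y - z)"
      by (simp only: prod.distrib prod_constant A(3))
    finally have e: "\<bar>\<Prod>k\<le>n. x - sgg_node l \<alpha> n k\<bar> = (l / 2) ^ Suc n * \<bar>\<Prod>z\<in>A. y - z\<bar>"
      using l by (simp only: abs_mult) simp
    have "K * \<bar>\<Prod>z\<in>A. y - z\<bar> = \<bar>poly p y\<bar>"
      using Kpos by (simp add: A(5) abs_mult)
    also have "\<dots> \<le> K * (2 ^ (n + 1) * ?M)"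
      using abs_gegenbauer_le[OF \<alpha> y, of n] by (simp add: p_def K_def mult_ac)
    finally have "\<bar>\<Prod>z\<in>A. y - z\<bar> \<le> 2 ^ (n + 1) * ?M"
      using Kpos by (simp only: mult_le_cancel_left_pos)
    then have "(l / 2) ^ Suc n * \<bar>\<Prod>z\<in>A. y - z\<bar> \<le> (l / 2) ^ Suc n * (2 ^ (n + 1) * ?M)"
      using l by (intro mult_left_mono) auto
    also have "\<dots> = l ^ (n + 1) * ?M"
      by (simp add: power_divide)
    finally show ?thesis unfolding e by simp
  qed
qed

text \<open>The definite description is met by the normalized product over the other nodes; two
  candidates differ by a polynomial of degree at most \<open>n\<close> with \<open>n + 1\<close>
  zeros.\<close>

lemma lagrange_poly:
  assumes inj: "inj_on (sgg_node l \<alpha> n) {..n}" and j: "j \<le> n"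
  shows "degree (lagrange_poly l \<alpha> n j) = n"
    and "k \<le> n \<Longrightarrow> poly (lagrange_poly l \<alpha> n j) (sgg_node l \<alpha> n k) = (if j = k then 1 else 0)"
proof -
  let ?x = "sgg_node l \<alpha> n"
  let ?P = "\<lambda>p. degree p = n \<and> (\<forall>k\<le>n. poly p (?x k) = (if j = k then 1 else 0))"
  define q where "q = (\<Prod>k\<in>{..n} - {j}. [:- ?x k, 1:])"
  define c where "c = (\<Prod>k\<in>{..n} - {j}. ?x j - ?x k)"
  have q: "poly q x = (\<Prod>k\<in>{..n} - {j}. x - ?x k)" for x by (simp add: q_def poly_prod)
  have c: "c \<noteq> 0" unfolding c_def using inj j by (auto simp: inj_on_def)
  have "degree q = card ({..n} - {j})" unfolding q_def
    by (subst degree_prod_eq_sum_degree) auto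
  then have "degree q = n" using j by simp
  moreover have "poly q (?x k) = (if j = k then c else 0)" if "k \<le> n" for k
    using that by (auto simp: q c_def intro!: prod_zero)
  ultimately have ex: "?P (smult (1 / c) q)" using c by simp
  have "p = p'" if p: "?P p" and p': "?P p'" for p p'
  proof (rule ccontr)
    assume "p \<noteq> p'"
    then have d: "p - p' \<noteq> 0" by simp
    have "?x ` {..n} \<subseteq> {x. poly (p - p') x = 0}" using p p' by auto
    then have "card (?x ` {..n}) \<le> card {x. poly (p - p') x = 0}"
      by (rule card_mono[OF poly_roots_finite[OF d]])
    also have "\<dots> \<le> degree (p - p')" by (rule card_poly_roots_bound[OF d])
    also have "\<dots> \<le> n" using p p' by (intro degree_diff_le) auto
    finally show False by (simp add: card_image[OF inj])
  qed
  with ex have "?P (lagrange_poly l \<alpha> n j)"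
    unfolding lagrange_poly_def by (intro theI[of ?P "smult (1 / c) q"])
  then show "degree (lagrange_poly l \<alpha> n j) = n"
    and "k \<le> n \<Longrightarrow> poly (lagrange_poly l \<alpha> n j) (?x k) = (if j = k then 1 else 0)"
    by auto
qed

section \<open>Rolle's theorem and the interpolation remainder\<close>

text \<open>Induction that splits off the largest zero: Rolle between the two largest gives a new
  zero of the derivative. Confining the zeros strictly between minimum and maximum keeps it distinct
  from the earlier ones.\<close>

lemma Rolle_finite_zeros:
  fixes g g' :: "real \<Rightarrow> real"
  assumes "\<And>x. x \<in> {a..b} \<Longrightarrow> (g has_real_derivative g' x) (at x within {a..b})"
    and "finite Z" "card Z = Suc m" "Z \<subseteq> {a..b}" "\<And>z. z \<in> Z \<Longrightarrow> g z = 0"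
  shows "\<exists>Z'. finite Z' \<and> card Z' = m \<and> Z' \<subseteq> {Min Z<..<Max Z} \<and> (\<forall>z\<in>Z'. g' z = 0)"
  using assms(2-)
proof (induction m arbitrary: Z)
  case 0
  then show ?case by (intro exI[of _ "{}"]) auto
next
  case (Suc m)
  define M where "M = Max Z"
  define Y where "Y = Z - {M}"
  have ne: "Z \<noteq> {}" using Suc.prems by auto
  have M: "M \<in> Z" unfolding M_def using Suc.prems ne by (intro Max_in)
  have Y: "finite Y" "card Y = Suc m" "Y \<subseteq> {a..b}" "\<And>z. z \<in> Y \<Longrightarrow> g z = 0"
    using Suc.prems M by (auto simp: Y_def)
  from Suc.IH[OF this] obtain Z' where Z': "finite Z'" "card Z' = m" "Z' \<subseteq> {Min Y<..<Max Y}"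
    "\<forall>z\<in>Z'. g' z = 0" by blast
  have Yne: "Y \<noteq> {}" using Y by auto
  define c where "c = Max Y"
  have c: "c \<in> Y" unfolding c_def using Y Yne by (intro Max_in)
  have cM: "c < M" using c Suc.prems(1) by (auto simp: Y_def M_def less_le)
  have sub: "{c..M} \<subseteq> {a..b}" using c M Suc.prems(3) by (auto simp: Y_def)
  have cont: "continuous_on {c..M} g"
    using assms(1) by (intro continuous_on_subset[OF _ sub] DERIV_continuous_on)
  have "\<exists>z. c < z \<and> z < M \<and> (\<lambda>v. g' z * v) = (\<lambda>v. 0)"
  proof (rule Rolle_deriv[OF cM _ cont])
    show "g c = g M" using Suc.prems(4) M c by (simp add: Y_def)
    fix x assume x: "c < x" "x < M"
    then have "a < x" "x < b" using sub cM by (auto dest: subsetD[of _ _ c] subsetD[of _ _ M])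
    then have "(g has_real_derivative g' x) (at x)"
      using assms(1)[of x] by (simp add: at_within_Icc_at)
    then show "(g has_derivative (\<lambda>v. g' x * v)) (at x)"
      by (simp add: has_field_derivative_def)
  qed
  then obtain z where z: "c < z" "z < M" "g' z = 0"
    by (metis mult.right_neutral)
  have "Min Z \<le> Min Y" using Yne Suc.prems(1) by (intro Min_antimono) (auto simp: Y_def)
  moreover have "Min Y \<le> c" using c Y by (intro Min_le)
  ultimately have "insert z Z' \<subseteq> {Min Z<..<Max Z}"
    using Z'(3) z cM by (auto simp flip: M_def c_def)
  moreover have "z \<notin> Z'" using Z'(3) z by (auto simp: c_def)
  ultimately show ?case
    using Z' z by (intro exI[of _ "insert z Z'"]) auto
qed

text \<open>Each differentiation costs one zero, and after the first all zeros lie in the open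
  interval. The family \<open>h\<close> stands for the successive derivatives.\<close>

lemma Rolle_iterated:
  fixes h :: "nat \<Rightarrow> real \<Rightarrow> real"
  assumes h: "\<And>k x. k < m \<Longrightarrow> x \<in> {a..b} \<Longrightarrow>
      (h k has_real_derivative h (Suc k) x) (at x within {a..b})"
    and Z: "finite Z" "card Z = Suc m" "Z \<subseteq> {a..b}" "\<And>z. z \<in> Z \<Longrightarrow> h 0 z = 0"
    and m: "m \<ge> 1"
  shows "\<exists>z\<in>{a<..<b}. h m z = 0"
proof -
  have "k \<le> m \<Longrightarrow> \<exists>Y. finite Y \<and> card Y = Suc (m - k) \<and> Y \<subseteq> {a..b} \<and>
      (k \<ge> 1 \<longrightarrow> Y \<subseteq> {a<..<b}) \<and> (\<forall>z\<in>Y. h k z = 0)" for k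
  proof (induction k)
    case 0
    then show ?case using Z by (intro exI[of _ Z]) auto
  next
    case (Suc k)
    then obtain Y where Y: "finite Y" "card Y = Suc (m - k)" "Y \<subseteq> {a..b}" "\<forall>z\<in>Y. h k z = 0"
      by auto
    obtain Y' where Y': "finite Y'" "card Y' = m - k" "Y' \<subseteq> {Min Y<..<Max Y}"
      "\<forall>z\<in>Y'. h (Suc k) z = 0"
      using Rolle_finite_zeros[of a b "h k" "h (Suc k)" Y "m - k"] h[of k] Y Suc.prems by auto
    have "Y \<noteq> {}" using Y by auto
    then have "Min Y \<in> Y" "Max Y \<in> Y" using Y by auto
    then have "a \<le> Min Y" "Max Y \<le> b" using Y(3) by auto
    with Y'(3) have "Y' \<subseteq> {a<..<b}" by fastforce
    moreover from this have "Y' \<subseteq> {a..b}" by force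
    moreover have "m - k = Suc (m - Suc k)" using Suc.prems by simp
    ultimately show ?case using Y' by auto
  qed
  from this[of m] obtain Y where "card Y = 1" "Y \<subseteq> {a<..<b}" "\<forall>z\<in>Y. h m z = 0"
    using m by auto
  moreover from this have "Y \<noteq> {}" by auto
  ultimately show ?thesis by blast
qed

lemma pderiv_funpow_const: "degree p \<le> n \<Longrightarrow> (pderiv ^^ n) p = [:fact n * coeff p n:]"
  for p :: "real poly"
proof (induction n arbitrary: p)
  case 0
  then show ?case by (auto elim!: degree_eq_zeroE)
next
  case (Suc n)
  have "(pderiv ^^ Suc n) p = (pderiv ^^ n) (pderiv p)" by (simp only: funpow_Suc_right o_apply)
  also have "\<dots> = [:fact n * coeff (pderiv p) n:]"
    using Suc.prems by (intro Suc.IH) (simp add: degree_pderiv)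
  finally show ?case by (simp add: coeff_pderiv algebra_simps)
qed

text \<open>Cauchy's remainder: a multiple of the node polynomial is subtracted so that the error
  also vanishes at \<open>x\<close>. This makes \<open>n + 2\<close> zeros, and iterated Rolle
  yields the point \<xi>.\<close>

lemma interpolation_error:
  fixes D :: "nat \<Rightarrow> real \<Rightarrow> real" and node :: "nat \<Rightarrow> real"
  assumes D: "\<And>k x. k \<le> n \<Longrightarrow> x \<in> {a..b} \<Longrightarrow>
      (D k has_real_derivative D (Suc k) x) (at x within {a..b})"
    and inj: "inj_on node {..n}" and nodes: "node ` {..n} \<subseteq> {a..b}"
    and p: "degree p \<le> n" "\<And>k. k \<le> n \<Longrightarrow> poly p (node k) = D 0 (node k)"
    and x: "x \<in> {a..b}" and ab: "a < b"
  shows "\<exists>\<xi>\<in>{a<..<b}. D 0 x - poly p x = D (Suc n) \<xi> / fact (Suc n) * (\<Prod>k\<le>n. x - node k)"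
proof (cases "x \<in> node ` {..n}")
  \<comment> \<open>At a node both sides are zero for any \<xi>; the midpoint is one choice.\<close>
  case True
  then obtain k where k: "k \<le> n" "x = node k" by auto
  then have "(\<Prod>k\<le>n. x - node k) = 0" by (intro prod_zero) auto
  moreover have "(a + b) / 2 \<in> {a<..<b}" using ab by (auto simp: field_simps)
  moreover have "D 0 x - poly p x = 0" using k p(2) by simp
  ultimately show ?thesis by (intro bexI[of _ "(a + b) / 2"]) simp_all
next
  case False
  define w where "w = (\<Prod>k\<le>n. [:- node k, 1:])"
  have w: "poly w y = (\<Prod>k\<le>n. y - node k)" for y by (simp add: w_def poly_prod)
  have wx: "poly w x \<noteq> 0" using False by (auto simp: w)
  have degw: "degree w = Suc n" unfolding w_def by (subst degree_prod_eq_sum_degree) auto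
  have "lead_coeff w = (\<Prod>k\<le>n. lead_coeff [:- node k, 1:])"
    unfolding w_def by (rule lead_coeff_prod)
  then have lw: "coeff w (Suc n) = 1" using degw by simp
  define c where "c = (D 0 x - poly p x) / poly w x"
  define q where "q = p + smult c w"
  define h where "h = (\<lambda>k y. D k y - poly ((pderiv ^^ k) q) y)"
  have "\<exists>\<xi>\<in>{a<..<b}. h (Suc n) \<xi> = 0"
  proof (rule Rolle_iterated[where Z = "insert x (node ` {..n})"])
    show "(h k has_real_derivative h (Suc k) y) (at y within {a..b})"
      if "k < Suc n" "y \<in> {a..b}" for k y
      unfolding h_def using D[of k y] that
      by (auto intro!: DERIV_diff has_field_derivative_at_within[OF poly_DERIV])
    show "card (insert x (node ` {..n})) = Suc (Suc n)"
      using False by (simp add: card_image[OF inj])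
    show "insert x (node ` {..n}) \<subseteq> {a..b}" using nodes x by simp
    show "h 0 z = 0" if z: "z \<in> insert x (node ` {..n})" for z
    proof (cases "z = x")
      case True
      then show ?thesis using wx by (simp add: h_def q_def c_def)
    next
      case False
      then obtain k where k: "k \<le> n" "z = node k" using z by auto
      then have "poly w z = 0" unfolding w by (intro prod_zero) auto
      then show ?thesis using k p(2) by (simp add: h_def q_def)
    qed
  qed auto
  then obtain \<xi> where \<xi>: "\<xi> \<in> {a<..<b}" "h (Suc n) \<xi> = 0" by blast
  have "degree q \<le> Suc n" unfolding q_def using p(1) degw
    by (intro degree_add_le degree_smult_le[THEN order_trans]) auto
  then have "(pderiv ^^ Suc n) q = [:fact (Suc n) * coeff q (Suc n):]"
    by (rule pderiv_funpow_const)
  moreover have "coeff q (Suc n) = c" using p(1) by (simp add: q_def lw coeff_eq_0)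
  ultimately have "D (Suc n) \<xi> = fact (Suc n) * c" using \<xi>(2) by (simp add: h_def del: funpow.simps)
  then have "c = D (Suc n) \<xi> / fact (Suc n)" by (simp del: fact_Suc)
  then have "D 0 x - poly p x = D (Suc n) \<xi> / fact (Suc n) * poly w x"
    using wx by (metis c_def nonzero_divide_eq_eq)
  with \<xi>(1) show ?thesis unfolding w by blast
qed

section \<open>Quadrature errors\<close>

lemma eps1_eq:
  "eps1 l \<alpha> n B x = B * l ^ (n + 1) * x / (4 ^ n * fact (n + 1) * Gamma (real n + \<alpha> + 1)) *
     gegenbauer_factor \<alpha> n"
  by (simp only: eps1_def gegenbauer_factor_def)

lemma D_const_eps1:
  "D_const \<alpha> * eps1 l \<alpha> n B x = x * (B / fact (n + 1) *
     (l ^ (n + 1) * D_const \<alpha> * gegenbauer_factor \<alpha> n / (4 ^ n * Gamma (real n + \<alpha> + 1))))"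
  unfolding eps1_eq by (simp add: mult_ac)

lemma gegenbauer_factor_nonneg:
  assumes "\<alpha> > -1/2"
  shows "gegenbauer_factor \<alpha> n \<ge> 0"
proof -
  have "Gamma (real n + 2 * \<alpha> + 1) \<ge> 0" using assms by (intro Gamma_real_nonneg) linarith
  moreover have "sqrt ((real n + 1) * (real n + 2 * \<alpha> + 1)) \<ge> 0"
    using assms by (intro real_sqrt_ge_zero mult_nonneg_nonneg) linarith+
  ultimately show ?thesis unfolding gegenbauer_factor_def
    by (simp only: split: if_split) (intro conjI impI divide_nonneg_nonneg mult_nonneg_nonneg; simp)
qed

lemma eps1_nonneg:
  assumes "\<alpha> > -1/2" "l > 0" "B \<ge> 0" "x \<ge> 0"
  shows "eps1 l \<alpha> n B x \<ge> 0"
proof -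
  have "Gamma (real n + \<alpha> + 1) \<ge> 0" using assms(1) by (intro Gamma_real_nonneg) linarith
  then show ?thesis unfolding eps1_eq using assms gegenbauer_factor_nonneg[OF assms(1)]
    by (intro mult_nonneg_nonneg divide_nonneg_nonneg) auto
qed

lemma eps1_mono:
  assumes "\<alpha> > -1/2" "l > 0" "B \<le> B'" "x \<ge> 0"
  shows "eps1 l \<alpha> n B x \<le> eps1 l \<alpha> n B' x"
proof -
  have "eps1 l \<alpha> n B' x - eps1 l \<alpha> n B x = eps1 l \<alpha> n (B' - B) x"
    by (simp add: eps1_def diff_divide_distrib left_diff_distrib)
  also have "\<dots> \<ge> 0" using assms by (intro eps1_nonneg) auto
  finally show ?thesis by simp
qed

text \<open>In \<open>eps2\<close> the factor \<open>Gamma (N + 2 \<alpha> + 1)\<close> stands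
  outside the cases and is divided out again for \<alpha> < 0. The remaining powers agree because
  \<open>2^(1 - N) = 2^(N + 1) / 4^N\<close>.\<close>

lemma eps2_eq_eps1:
  assumes "\<alpha> > -1/2"
  shows "eps2 L \<alpha> N A nmax x = eps1 L \<alpha> N (2 ^ (N + 1) * A * nmax) x"
proof -
  have "real N + 2 * \<alpha> + 1 > 0" using assms by linarith
  then have G: "Gamma (real N + 2 * \<alpha> + 1) \<noteq> 0" using Gamma_real_pos by (metis less_irrefl)
  have "2 powr (1 - real N) = 2 powr 1 / 2 powr real N" by (rule powr_diff)
  then have p: "2 powr (1 - real N) = 2 / 2 ^ N" by (simp add: powr_realpow)
  have 4: "(4::real) ^ N = 2 ^ N * 2 ^ N" by (simp flip: power_mult_distrib)
  have e: "2 ^ (N + 1) * A * nmax * L ^ (N + 1) * x / (4 ^ N * fact (N + 1) * Gamma (real N + \<alpha> + 1))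
      = A * nmax * (2 / 2 ^ N) * x * L ^ (N + 1) / (fact (N + 1) * Gamma (1 + real N + \<alpha>))"
    unfolding 4 by (simp add: add_ac mult_ac)
  show ?thesis unfolding eps1_def eps2_def p e using G
    by (simp only: if_distrib[of "\<lambda>z. _ * z"]) (simp add: mult_ac)
qed

section \<open>Errors of the single and the double integral\<close>

lemma deriv_within_has_real_derivative:
  assumes "times_differentiable_on n S g" "k < n" "x \<in> S"
  shows "(deriv_within S k g has_real_derivative deriv_within S (Suc k) g x) (at x within S)"
proof -
  have "deriv_within S k g differentiable (at x within S)"
    using assms by (auto simp: times_differentiable_on_def differentiable_on_def)
  then have "(deriv_within S k g has_vector_derivative
      vector_derivative (deriv_within S k g) (at x within S)) (at x within S)"
    by (simp add: vector_derivative_works)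
  then show ?thesis
    by (simp add: has_real_derivative_iff_has_vector_derivative deriv_within_def)
qed

lemma iter_integral_0: "iter_integral 0 g = g"
  by (rule ext) simp

text \<open>Cauchy's formula for repeated integration, by parts: \<open>(x - s) G s\<close> vanishes
  at both ends.\<close>

lemma iter_integral_2:
  assumes cont: "continuous_on {0..x} g" and x: "x \<ge> 0"
  shows "iter_integral 2 g x = integral {0..x} (\<lambda>s. (x - s) * g s)"
proof -
  define G where "G = (\<lambda>s. integral {0..s} g)"
  have dG: "(G has_vector_derivative g s) (at s within {0..x})" if "s \<in> {0..x}" for s
    unfolding G_def using that by (rule integral_has_vector_derivative[OF cont])
  have "((\<lambda>s. (x - s) * g s - G s) has_integral (x - x) * G x - (x - 0) * G 0) {0..x}"
  proof (rule fundamental_theorem_of_calculus[OF x])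
    fix s assume "s \<in> {0..x}"
    then show "((\<lambda>s. (x - s) * G s) has_vector_derivative (x - s) * g s - G s) (at s within {0..x})"
      using dG[of s] unfolding has_real_derivative_iff_has_vector_derivative[symmetric]
      by (auto intro!: derivative_eq_intros)
  qed
  then have "integral {0..x} (\<lambda>s. (x - s) * g s - G s) = 0"
    by (intro integral_unique) (simp add: G_def)
  moreover have "G integrable_on {0..x}"
    unfolding G_def
    by (intro integrable_continuous_real indefinite_integral_continuous_1 cont)
  moreover have "(\<lambda>s. (x - s) * g s) integrable_on {0..x}"
    by (intro integrable_continuous_real continuous_intros cont)
  ultimately have "integral {0..x} (\<lambda>s. (x - s) * g s) = integral {0..x} G"
    by (simp add: integral_diff)
  then show ?thesis by (simp add: numeral_2_eq_2 G_def cong: integral_cong)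
qed

text \<open>The quadrature sum is the integral of the interpolant \<open>p\<close>, so the error is
  the integral of the interpolation error, at most the length times its maximum.\<close>

lemma quadrature_error:
  fixes D :: "nat \<Rightarrow> real \<Rightarrow> real"
  assumes \<alpha>: "\<alpha> > -1/2" and l: "l > 0" and i: "i \<le> n"
    and D: "\<And>k x. k \<le> n \<Longrightarrow> x \<in> {0..l} \<Longrightarrow>
      (D k has_real_derivative D (Suc k) x) (at x within {0..l})"
  shows "\<exists>\<xi>\<in>{0<..<l}.
    \<bar>integral {0..sgg_node l \<alpha> n i} (D 0) -
      (\<Sum>j\<le>n. integral {0..sgg_node l \<alpha> n i} (poly (lagrange_poly l \<alpha> n j)) * D 0 (sgg_node l \<alpha> n j))\<bar>
      \<le> D_const \<alpha> * eps1 l \<alpha> n \<bar>D (Suc n) \<xi>\<bar> (sgg_node l \<alpha> n i)"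
proof -
  let ?x = "sgg_node l \<alpha> n"
  define M where "M = l ^ (n + 1) * D_const \<alpha> * gegenbauer_factor \<alpha> n / (4 ^ n * Gamma (real n + \<alpha> + 1))"
  note inj = inj_on_sgg_node[OF \<alpha> l, of n]
  note bnd = sgg_node_bounds[OF \<alpha> l, of _ n]
  define p where "p = (\<Sum>j\<le>n. smult (D 0 (?x j)) (lagrange_poly l \<alpha> n j))"
  have degp: "degree p \<le> n" unfolding p_def
    by (intro degree_sum_le degree_smult_le[THEN order_trans]) (auto simp: lagrange_poly(1)[OF inj])
  have p: "poly p (?x k) = D 0 (?x k)" if "k \<le> n" for k
  proof -
    have "poly p (?x k) = (\<Sum>j\<le>n. if j = k then D 0 (?x k) else 0)"
      unfolding p_def poly_sum using that
      by (intro sum.cong) (auto simp: lagrange_poly(2)[OF inj])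
    then show ?thesis using that by simp
  qed
  have xi: "0 < ?x i" "?x i < l" using bnd[OF i] by auto
  have intpoly: "poly q integrable_on {0..?x i}" for q :: "real poly"
    by (intro integrable_continuous_real continuous_intros)
  have "integral {0..?x i} (poly p) = (\<Sum>j\<le>n. integral {0..?x i} (\<lambda>x. D 0 (?x j) * poly (lagrange_poly l \<alpha> n j) x))"
    unfolding p_def poly_sum poly_smult
    by (intro integral_sum integrable_on_mult_right intpoly) auto
  then have intp: "(\<Sum>j\<le>n. integral {0..?x i} (poly (lagrange_poly l \<alpha> n j)) * D 0 (?x j)) = integral {0..?x i} (poly p)"
    by (simp add: mult.commute)
  have cont: "continuous_on {0..?x i} (D 0)"
    using D[of 0] xi by (intro continuous_on_subset[OF DERIV_continuous_on[of "{0..l}"]]) auto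
  then have cont': "continuous_on {0..?x i} (\<lambda>x. \<bar>D 0 x - poly p x\<bar>)"
    by (intro continuous_intros)
  \<comment> \<open>The remainder formula is applied only at this maximizer, so a single \<xi>
    serves the whole integral.\<close>
  obtain y where y: "y \<in> {0..?x i}" "\<And>x. x \<in> {0..?x i} \<Longrightarrow> \<bar>D 0 x - poly p x\<bar> \<le> \<bar>D 0 y - poly p y\<bar>"
    using continuous_attains_sup[OF _ _ cont'] xi by auto
  have nodes: "?x ` {..n} \<subseteq> {0..l}" using bnd by (fastforce intro: less_imp_le)
  have yl: "y \<in> {0..l}" using y(1) xi by auto
  obtain \<xi> where \<xi>: "\<xi> \<in> {0<..<l}"
    "D 0 y - poly p y = D (Suc n) \<xi> / fact (Suc n) * (\<Prod>k\<le>n. y - ?x k)"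
    using interpolation_error[where D = D, OF D inj nodes degp p yl l] by blast
  have int: "(\<lambda>x. D 0 x - poly p x) integrable_on {0..?x i}"
    by (intro integrable_continuous_real continuous_intros cont)
  have "integral {0..?x i} (D 0) - integral {0..?x i} (poly p) = integral {0..?x i} (\<lambda>x. D 0 x - poly p x)"
    by (intro integral_diff[symmetric] integrable_continuous_real cont continuous_intros)
  also have "\<bar>\<dots>\<bar> \<le> integral {0..?x i} (\<lambda>x. \<bar>D 0 y - poly p y\<bar>)"
    using integral_norm_bound_integral[OF int integrable_const_ivl] y(2) by simp
  also have "\<dots> = ?x i * \<bar>D 0 y - poly p y\<bar>" using xi by simp
  also have "\<dots> = ?x i * (\<bar>D (Suc n) \<xi>\<bar> / fact (Suc n) * \<bar>\<Prod>k\<le>n. y - ?x k\<bar>)"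
    unfolding \<xi>(2) by (simp only: abs_mult abs_divide abs_of_nonneg[OF fact_ge_zero])
  also have "\<dots> \<le> ?x i * (\<bar>D (Suc n) \<xi>\<bar> / fact (Suc n) * M)"
    using abs_prod_sgg_node_le[OF \<alpha> l yl] xi
    by (intro mult_left_mono) (auto simp: M_def)
  also have "\<dots> = D_const \<alpha> * eps1 l \<alpha> n \<bar>D (Suc n) \<xi>\<bar> (?x i)"
    by (simp only: D_const_eps1 M_def Suc_eq_plus1)
  finally show ?thesis using \<xi>(1) intp by auto
qed

lemma abs_le_of_sup_norm_on:
  assumes "sup_norm_on A g \<le> ereal c" "z \<in> A"
  shows "\<bar>g z\<bar> \<le> c"
proof -
  have "ereal \<bar>g z\<bar> \<le> sup_norm_on A g"
    unfolding sup_norm_on_def using assms(2) by (rule SUP_upper)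
  then show ?thesis using assms(1) by (metis ereal_less_eq(3) order_trans)
qed

lemma D_const_nonneg: "\<alpha> > -1/2 \<Longrightarrow> D_const \<alpha> \<ge> 0"
  unfolding D_const_def by (intro divide_nonneg_nonneg) auto

lemma double_integral_error:
  fixes F :: "nat \<Rightarrow> real \<Rightarrow> real"
  assumes \<alpha>: "\<alpha> > -1/2" and l: "l > 0" and i: "i \<le> n"
    and F: "\<And>k x. k \<le> n \<Longrightarrow> x \<in> {0..l} \<Longrightarrow>
      (F k has_real_derivative F (Suc k) x) (at x within {0..l})"
    and A: "\<And>k x. k \<le> Suc n \<Longrightarrow> x \<in> {0..l} \<Longrightarrow> \<bar>F k x\<bar> \<le> A"
  shows "\<exists>\<xi>\<in>{0<..<l}.
    \<bar>iter_integral 2 (F 0) (sgg_node l \<alpha> n i) - (\<Sum>j\<le>n. bsgim l \<alpha> 2 n i j * F 0 (sgg_node l \<alpha> n j))\<bar>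
      \<le> D_const \<alpha> * eps2 l \<alpha> n A (max 1 \<bar>sgg_node l \<alpha> n i - \<xi>\<bar>) (sgg_node l \<alpha> n i)"
proof -
  define c where "c = sgg_node l \<alpha> n i"
  have c: "0 < c" "c < l" using sgg_node_bounds[OF \<alpha> l i] by (auto simp: c_def)
  txt \<open>
    The double integral is the integral of \<open>(c - s) * F 0 s\<close>, and the second order matrix applies the
    first order rule to this function, whose derivatives are the \<open>D k\<close> by Leibniz' rule. For \<open>k = 0\<close>
    the truncated index \<open>k - 1\<close> is harmless.
  \<close>
  define D where "D = (\<lambda>k x. (c - x) * F k x - real k * F (k - 1) x)"
  have D: "(D k has_real_derivative D (Suc k) x) (at x within {0..l})"
    if "k \<le> n" "x \<in> {0..l}" for k x
  proof (cases k)
    case 0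
    then show ?thesis unfolding D_def using F[OF that]
      by (auto intro!: derivative_eq_intros)
  next
    case (Suc m)
    then have "(F m has_real_derivative F k x) (at x within {0..l})"
      using F[of m x] that by simp
    then show ?thesis unfolding D_def using F[OF that] Suc
      by (auto intro!: derivative_eq_intros simp: algebra_simps)
  qed
  obtain \<xi> where \<xi>: "\<xi> \<in> {0<..<l}"
    "\<bar>integral {0..c} (D 0) - (\<Sum>j\<le>n. integral {0..c} (poly (lagrange_poly l \<alpha> n j)) * D 0 (sgg_node l \<alpha> n j))\<bar>
      \<le> D_const \<alpha> * eps1 l \<alpha> n \<bar>D (Suc n) \<xi>\<bar> c"
    using quadrature_error[where D = D, OF \<alpha> l i D] unfolding c_def by blast
  have cont: "continuous_on {0..c} (F 0)"
    using F[of 0] c by (intro continuous_on_subset[OF DERIV_continuous_on[of "{0..l}"]]) auto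
  have e1: "iter_integral 2 (F 0) c = integral {0..c} (D 0)"
    using iter_integral_2[OF cont] c by (simp add: D_def)
  have e2: "(\<Sum>j\<le>n. bsgim l \<alpha> 2 n i j * F 0 (sgg_node l \<alpha> n j)) =
      (\<Sum>j\<le>n. integral {0..c} (poly (lagrange_poly l \<alpha> n j)) * D 0 (sgg_node l \<alpha> n j))"
    by (simp add: bsgim_def D_def c_def mult_ac)
  define r where "r = max 1 \<bar>c - \<xi>\<bar>"
  have "\<bar>F 0 0\<bar> \<le> A" using l by (intro A) auto
  then have A0: "A \<ge> 0" using abs_ge_zero order.trans by blast
  have "\<bar>D (Suc n) \<xi>\<bar> \<le> \<bar>c - \<xi>\<bar> * \<bar>F (Suc n) \<xi>\<bar> + real (Suc n) * \<bar>F n \<xi>\<bar>"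
    unfolding D_def by (rule order.trans[OF abs_triangle_ineq4]) (simp add: abs_mult)
  also have "\<dots> \<le> r * A + real (Suc n) * A"
    using A[of "Suc n" \<xi>] A[of n \<xi>] \<xi>(1) by (intro add_mono mult_mono) (auto simp: r_def)
  \<comment> \<open>Here \<open>r \<ge> 1\<close> is used, which is why 1 appears in the maximum:
    both summands become multiples of \<open>A * r\<close>.\<close>
  also have "\<dots> \<le> r * A + real (Suc n) * (A * r)"
    using A0 by (intro add_left_mono mult_left_mono) (auto simp: r_def mult_le_cancel_left1)
  also have "\<dots> = real (n + 2) * (A * r)" by (simp add: algebra_simps)
  also have "\<dots> \<le> 2 ^ (n + 1) * (A * r)"
  proof (rule mult_right_mono)
    have "n + 2 \<le> 2 ^ (n + 1)" by (induction n) auto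
    then have "real (n + 2) \<le> real (2 ^ (n + 1))" by (rule of_nat_mono)
    then show "real (n + 2) \<le> 2 ^ (n + 1)" by simp
    show "0 \<le> A * r" using A0 by (simp add: r_def)
  qed
  finally have "\<bar>D (Suc n) \<xi>\<bar> \<le> 2 ^ (n + 1) * A * r" by (simp add: mult_ac)
  then have "eps1 l \<alpha> n \<bar>D (Suc n) \<xi>\<bar> c \<le> eps2 l \<alpha> n A r c"
    unfolding eps2_eq_eps1[OF \<alpha>] using c by (intro eps1_mono[OF \<alpha> l]) auto
  then have "D_const \<alpha> * eps1 l \<alpha> n \<bar>D (Suc n) \<xi>\<bar> c \<le> D_const \<alpha> * eps2 l \<alpha> n A r c"
    by (rule mult_left_mono[OF _ D_const_nonneg[OF \<alpha>]])
  with \<xi> e1 e2 show ?thesis unfolding r_def c_def by (intro bexI[of _ \<xi>]) auto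
qed

lemma eps2_mono:
  assumes "\<alpha> > -1/2" "l > 0" "A \<ge> 0" "r \<le> r'" "x \<ge> 0"
  shows "eps2 l \<alpha> n A r x \<le> eps2 l \<alpha> n A r' x"
  unfolding eps2_eq_eps1[OF assms(1)] using assms
  by (intro eps1_mono mult_left_mono) auto

section \<open>Common intermediate points and the total error\<close>

lemma arg_max_nat_le:
  fixes h :: "nat \<Rightarrow> real"
  obtains m where "m \<le> n" "\<And>i. i \<le> n \<Longrightarrow> h i \<le> h m"
proof -
  have "Max (h ` {..n}) \<in> h ` {..n}" by (intro Max_in) auto
  then obtain m where "m \<le> n" "h m = Max (h ` {..n})" by (metis atMost_iff imageE)
  with that show ?thesis by (metis Max_ge atMost_iff finite_atMost finite_imageI imageI)
qed

text \<open>The intermediate points are fixed before \<open>Bmax\<close>, since the condition on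
  \<open>Bmax\<close> refers to them. With fixed points the supremum in the definition of the
  maximum is over a single number.\<close>

theorem theorem5p5:
  fixes L tf \<alpha> Amax :: real and Ny Nt :: nat
    and \<phi> u :: "real \<Rightarrow> real \<Rightarrow> real" and f :: "real \<Rightarrow> real"
  assumes "L > 0" and "tf > 0" and "\<alpha> > -1/2" and "Ny \<ge> 1" and "Nt \<ge> 1"
    and "\<And>y. y \<in> {0..L} \<Longrightarrow> C_class_on (Nt + 1) {0..tf} (psi \<phi> u y)"
    and "\<And>t. t \<in> {0..tf} \<Longrightarrow> times_differentiable_on (Ny + 1) {0..L} (\<lambda>y. \<phi> y t)"
    and "Amax > 0"
    and "\<And>k. k \<le> Ny + 1 \<Longrightarrow>
           sup_norm_on ({0..L} \<times> {0..tf}) (\<lambda>(y, t). deriv_within {0..L} k (\<lambda>s. \<phi> s t) y)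
             \<le> ereal Amax"
  shows "\<exists>\<zeta>y \<zeta>t :: nat \<Rightarrow> real.
    (\<forall>i\<le>Ny. \<zeta>y i \<in> {0<..<L}) \<and> (\<forall>j\<le>Nt. \<zeta>t j \<in> {0<..<tf}) \<and>
    (\<forall>Bmax :: nat \<Rightarrow> real.
       (\<forall>j\<le>Nt. Bmax j > 0 \<and>
          sup_norm_on {0..L} (\<lambda>y. deriv_within {0..tf} (Nt + 1) (psi \<phi> u y) (\<zeta>t j))
            \<le> ereal (Bmax j)) \<longrightarrow>
       (\<forall>i\<le>Ny. \<forall>j\<le>Nt.
          (ids_lhs \<phi> u (sgg_node L \<alpha> Ny i) (sgg_node tf \<alpha> Nt j)
              = f (sgg_node L \<alpha> Ny i) - f 0 \<longrightarrow>
           bsgpm_lhs L tf \<alpha> Ny Nt \<phi> u i j + E_total L tf \<alpha> Ny Nt \<phi> u i j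
              = f (sgg_node L \<alpha> Ny i) - f 0) \<and>
          \<bar>E_total L tf \<alpha> Ny Nt \<phi> u i j\<bar>
            \<le> D_const \<alpha> *
               (eps1 tf \<alpha> Nt (Bmax j) (sgg_node tf \<alpha> Nt j) +
                eps2 L \<alpha> Ny Amax (max 1 \<bar>sgg_node L \<alpha> Ny i - \<zeta>y i\<bar>) (sgg_node L \<alpha> Ny i))))"
proof -
  note L = assms(1) and tf = assms(2) and \<alpha> = assms(3)
  define y where "y = sgg_node L \<alpha> Ny"
  define t where "t = sgg_node tf \<alpha> Nt"
  have y: "0 < y i" "y i < L" if "i \<le> Ny" for i
    using sgg_node_bounds[OF \<alpha> L that] by (auto simp: y_def)
  have t: "0 < t j" "t j < tf" if "j \<le> Nt" for j
    using sgg_node_bounds[OF \<alpha> tf that] by (auto simp: t_def)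
  define Ey where "Ey = (\<lambda>i j. iter_integral 2 (\<lambda>s. \<phi> s (t j)) (y i) -
    (\<Sum>s\<le>Ny. bsgim L \<alpha> 2 Ny i s * \<phi> (y s) (t j)))"
  define Et where "Et = (\<lambda>i j. iter_integral 1 (psi \<phi> u (y i)) (t j) -
    (\<Sum>k\<le>Nt. bsgim tf \<alpha> 1 Nt j k * psi \<phi> u (y i) (t k)))"
  have E: "E_total L tf \<alpha> Ny Nt \<phi> u i j = Ey i j + Et i j" for i j
    by (simp add: E_total_def ids_lhs_def bsgpm_lhs_def Ey_def Et_def y_def t_def)
  have d0: "deriv_within S 0 g = g" for S g by (simp add: deriv_within_def)
  let ?d = "\<lambda>i. deriv_within {0..tf} (Nt + 1) (psi \<phi> u (y i))"
  have "\<exists>\<xi>\<in>{0<..<L}. \<bar>Ey i j\<bar> \<le> D_const \<alpha> * eps2 L \<alpha> Ny Amax (max 1 \<bar>y i - \<xi>\<bar>) (y i)"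
    if ij: "i \<le> Ny" "j \<le> Nt" for i j
  proof -
    have tj: "t j \<in> {0..tf}" using t[OF ij(2)] by simp
    have "\<exists>\<xi>\<in>{0<..<L}. \<bar>iter_integral 2 (deriv_within {0..L} 0 (\<lambda>s. \<phi> s (t j))) (sgg_node L \<alpha> Ny i) -
        (\<Sum>s\<le>Ny. bsgim L \<alpha> 2 Ny i s * deriv_within {0..L} 0 (\<lambda>s. \<phi> s (t j)) (sgg_node L \<alpha> Ny s))\<bar>
      \<le> D_const \<alpha> * eps2 L \<alpha> Ny Amax (max 1 \<bar>sgg_node L \<alpha> Ny i - \<xi>\<bar>) (sgg_node L \<alpha> Ny i)"
    proof (rule double_integral_error[OF \<alpha> L ij(1)])
      show "(deriv_within {0..L} k (\<lambda>s. \<phi> s (t j)) has_real_derivative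
          deriv_within {0..L} (Suc k) (\<lambda>s. \<phi> s (t j)) x) (at x within {0..L})"
        if "k \<le> Ny" "x \<in> {0..L}" for k x
        using that by (intro deriv_within_has_real_derivative[OF assms(7)[OF tj]]) auto
      show "\<bar>deriv_within {0..L} k (\<lambda>s. \<phi> s (t j)) x\<bar> \<le> Amax" if "k \<le> Suc Ny" "x \<in> {0..L}" for k x
        \<comment> \<open>The norm over the rectangle is a pointwise supremum, so it bounds values
          on the line \<open>t = t j\<close>.\<close>
        using abs_le_of_sup_norm_on[OF assms(9)[of k], of "(x, t j)"] that tj by simp
    qed
    then show ?thesis by (simp only: d0 Ey_def y_def)
  qed
  then obtain \<xi>y where \<xi>y: "\<And>i j. i \<le> Ny \<Longrightarrow> j \<le> Nt \<Longrightarrow> \<xi>y i j \<in> {0<..<L}"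
    "\<And>i j. i \<le> Ny \<Longrightarrow> j \<le> Nt \<Longrightarrow>
      \<bar>Ey i j\<bar> \<le> D_const \<alpha> * eps2 L \<alpha> Ny Amax (max 1 \<bar>y i - \<xi>y i j\<bar>) (y i)"
    by metis
  have "\<exists>\<xi>\<in>{0<..<tf}. \<bar>Et i j\<bar> \<le> D_const \<alpha> * eps1 tf \<alpha> Nt \<bar>?d i \<xi>\<bar> (t j)"
    if ij: "i \<le> Ny" "j \<le> Nt" for i j
  proof -
    have yi: "y i \<in> {0..L}" using y[OF ij(1)] by simp
    then have "times_differentiable_on (Nt + 1) {0..tf} (psi \<phi> u (y i))"
      using assms(6) by (simp add: C_class_on_def)
    from deriv_within_has_real_derivative[OF this] have
      "(deriv_within {0..tf} k (psi \<phi> u (y i)) has_real_derivative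
        deriv_within {0..tf} (Suc k) (psi \<phi> u (y i)) x) (at x within {0..tf})"
      if "k \<le> Nt" "x \<in> {0..tf}" for k x using that by simp
    from quadrature_error[where D = "\<lambda>k. deriv_within {0..tf} k (psi \<phi> u (y i))", OF \<alpha> tf ij(2) this]
    show ?thesis by (simp add: d0 Et_def t_def bsgim_def iter_integral_0)
  qed
  then obtain \<xi>t where \<xi>t: "\<And>i j. i \<le> Ny \<Longrightarrow> j \<le> Nt \<Longrightarrow> \<xi>t i j \<in> {0<..<tf}"
    "\<And>i j. i \<le> Ny \<Longrightarrow> j \<le> Nt \<Longrightarrow>
      \<bar>Et i j\<bar> \<le> D_const \<alpha> * eps1 tf \<alpha> Nt \<bar>?d i (\<xi>t i j)\<bar> (t j)"
    by metis
  txt \<open>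
    The intermediate points depend on both indices. Choosing the worst index makes one point
    per node serve all of them.
  \<close>
  have "\<exists>m\<le>Nt. \<forall>j\<le>Nt. \<bar>y i - \<xi>y i j\<bar> \<le> \<bar>y i - \<xi>y i m\<bar>" for i
    using arg_max_nat_le[of Nt "\<lambda>j. \<bar>y i - \<xi>y i j\<bar>"] by metis
  then obtain my where my: "\<And>i. my i \<le> Nt"
    "\<And>i j. j \<le> Nt \<Longrightarrow> \<bar>y i - \<xi>y i j\<bar> \<le> \<bar>y i - \<xi>y i (my i)\<bar>" by metis
  have "\<exists>m\<le>Ny. \<forall>i\<le>Ny. \<bar>?d i (\<xi>t i j)\<bar> \<le> \<bar>?d m (\<xi>t m j)\<bar>" for j
    using arg_max_nat_le[of Ny "\<lambda>i. \<bar>?d i (\<xi>t i j)\<bar>"] by metis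
  then obtain mt where mt: "\<And>j. mt j \<le> Ny"
    "\<And>i j. i \<le> Ny \<Longrightarrow> \<bar>?d i (\<xi>t i j)\<bar> \<le> \<bar>?d (mt j) (\<xi>t (mt j) j)\<bar>" by metis
  define \<zeta>y where "\<zeta>y = (\<lambda>i. \<xi>y i (my i))"
  define \<zeta>t where "\<zeta>t = (\<lambda>j. \<xi>t (mt j) j)"
  show ?thesis
  proof (rule exI[of _ \<zeta>y], rule exI[of _ \<zeta>t], intro conjI allI impI)
    show "\<zeta>y i \<in> {0<..<L}" if "i \<le> Ny" for i using \<xi>y(1)[OF that my(1)] by (simp add: \<zeta>y_def)
    show "\<zeta>t j \<in> {0<..<tf}" if "j \<le> Nt" for j using \<xi>t(1)[OF mt(1) that] by (simp add: \<zeta>t_def)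
  next
    fix Bmax :: "nat \<Rightarrow> real" and i j
    assume B: "\<forall>j\<le>Nt. Bmax j > 0 \<and>
          sup_norm_on {0..L} (\<lambda>y. deriv_within {0..tf} (Nt + 1) (psi \<phi> u y) (\<zeta>t j))
            \<le> ereal (Bmax j)" and i: "i \<le> Ny" and j: "j \<le> Nt"
    show "bsgpm_lhs L tf \<alpha> Ny Nt \<phi> u i j + E_total L tf \<alpha> Ny Nt \<phi> u i j
        = f (sgg_node L \<alpha> Ny i) - f 0"
      if "ids_lhs \<phi> u (sgg_node L \<alpha> Ny i) (sgg_node tf \<alpha> Nt j) = f (sgg_node L \<alpha> Ny i) - f 0"
      using that by (simp add: E_total_def)
    \<comment> \<open>The point chosen for \<open>j\<close> belongs to the worst node
      \<open>y (mt j)\<close>; the assumed norm at that fixed time runs over all of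
      \<open>[0, L]\<close> and so covers this node.\<close>
    have "\<bar>?d i (\<xi>t i j)\<bar> \<le> \<bar>?d (mt j) (\<zeta>t j)\<bar>" using mt(2)[OF i] by (simp add: \<zeta>t_def)
    also have "\<dots> \<le> Bmax j"
      using abs_le_of_sup_norm_on[of "{0..L}" _ "Bmax j" "y (mt j)"] B j y[OF mt(1)[of j]] by fastforce
    finally have "eps1 tf \<alpha> Nt \<bar>?d i (\<xi>t i j)\<bar> (t j) \<le> eps1 tf \<alpha> Nt (Bmax j) (t j)"
      using t[OF j] by (intro eps1_mono[OF \<alpha> tf]) auto
    then have 1: "\<bar>Et i j\<bar> \<le> D_const \<alpha> * eps1 tf \<alpha> Nt (Bmax j) (t j)"
      by (intro order.trans[OF \<xi>t(2)[OF i j]] mult_left_mono D_const_nonneg[OF \<alpha>])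
    have "eps2 L \<alpha> Ny Amax (max 1 \<bar>y i - \<xi>y i j\<bar>) (y i) \<le> eps2 L \<alpha> Ny Amax (max 1 \<bar>y i - \<zeta>y i\<bar>) (y i)"
      using y[OF i] my(2)[OF j, of i] assms(8)
      by (intro eps2_mono[OF \<alpha> L]) (auto simp: \<zeta>y_def)
    then have 2: "\<bar>Ey i j\<bar> \<le> D_const \<alpha> * eps2 L \<alpha> Ny Amax (max 1 \<bar>y i - \<zeta>y i\<bar>) (y i)"
      by (intro order.trans[OF \<xi>y(2)[OF i j]] mult_left_mono D_const_nonneg[OF \<alpha>])
    have "\<bar>Ey i j + Et i j\<bar> \<le> \<bar>Ey i j\<bar> + \<bar>Et i j\<bar>" by (rule abs_triangle_ineq)
    with 1 2 show "\<bar>E_total L tf \<alpha> Ny Nt \<phi> u i j\<bar> \<le> D_const \<alpha> *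
        (eps1 tf \<alpha> Nt (Bmax j) (sgg_node tf \<alpha> Nt j) +
         eps2 L \<alpha> Ny Amax (max 1 \<bar>sgg_node L \<alpha> Ny i - \<zeta>y i\<bar>) (sgg_node L \<alpha> Ny i))"
      by (simp add: E y_def t_def distrib_left)
  qed
qed

end
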